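(* Let $a,b$ be axes in $A$ and suppose $(a,b)\notin\{1,\frac14\}$. Then for all $x_{1/2},y_{1/2}\in A_{1/2}(a)$ and $y_0\in A_0(a)$: (1) $b_{1/2}(x_{1/2}y_{1/2})+(b_{1/2}x_{1/2})y_{1/2}+(b_{1/2}y_{1/2})x_{1/2}=\frac12(b,y_{1/2})x_{1/2}+\frac12(b,x_{1/2})y_{1/2}+(a,x_{1/2}y_{1/2})b_{1/2}$. (2) $\big(b_{1/2}(x_{1/2}y_0)\big)_0=(b_{1/2}x_{1/2})y_0-\big((b_{1/2}y_0)x_{1/2}\big)_0$. In particular, $[L_a,L_b]$ is a derivation on $A$.
   Context: $\mathbb{F}$ is a field of characteristic not $2$ and $A$ is a commutative, not necessarily associative, $\mathbb{F}$-algebra equipped with a Frobenius form, i.e. a symmetric bilinear form $(\cdot,\cdot):A\times A\to\mathbb{F}$ with $(xy,z)=(x,yz)$ for all $x,y,z\in A$. For $z\in A$ and $\lambda\in\mathbb{F}$ put $A_\lambda(z)=\{x\in A: zx=\lambda x\}$. An axis is an idempotent $c\in A$ (so $c^2=c$) such that $(c,c)=1$, $A=\mathbb{F}c\oplus A_0(c)\oplus A_{1/2}(c)$, and the fusion rules hold: for $x_0,y_0\in A_0(c)$ and $x_{1/2},y_{1/2}\in A_{1/2}(c)$ one has $x_0y_0\in A_0(c)$, $x_0y_{1/2}\in A_{1/2}(c)$, $x_{1/2}y_{1/2}\in\mathbb{F}c+A_0(c)$. Given the axis $a$, each $x\in A$ is written uniquely $x=(a,x)a+x_0+x_{1/2}$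 with $x_\lambda\in A_\lambda(a)$, $\lambda\in\{0,\frac12\}$; $(x)_0$ and $(x)_{1/2}$ also denote these components. In particular $b=(a,b)a+b_0+b_{1/2}$. For $x\in A$, $L_x(y)=xy$, and $[L_x,L_y]=L_xL_y-L_yL_x$. A derivation on $A$ is an $\mathbb{F}$-linear map $D:A\to A$ with $D(xy)=xD(y)+D(x)y$ for all $x,y\in A$. *)

theory Defs
  imports Complex_Main
begin

text \<open>
  A commutative, not necessarily associative algebra over a field \<open>'f\<close> with a Frobenius form.  The
  underlying vector space is a whole type \<open>'a\<close> with scalar multiplication \<open>scale\<close>.  Linearity is only
  required in one argument of the product and of the form; commutativity and symmetry give
  the other one.
\<close>

locale frobenius_algebra = vector_space scale
  for scale :: "'f::field \<Rightarrow> 'a::ab_group_add \<Rightarrow> 'a" +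
  fixes mult :: "'a \<Rightarrow> 'a \<Rightarrow> 'a"  (infixl \<open>\<bullet>\<close> 70)
    and form :: "'a \<Rightarrow> 'a \<Rightarrow> 'f"
  assumes mult_linear: "Vector_Spaces.linear scale scale (\<lambda>y. x \<bullet> y)"
    and mult_commute: "x \<bullet> y = y \<bullet> x"
    and form_linear: "Vector_Spaces.linear scale (*) (\<lambda>y. form x y)"
    and form_commute: "form x y = form y x"
    and form_assoc: "form (x \<bullet> y) z = form x (y \<bullet> z)"

definition eigenspace ::
    "('f::field \<Rightarrow> 'a::ab_group_add \<Rightarrow> 'a) \<Rightarrow> ('a \<Rightarrow> 'a \<Rightarrow> 'a) \<Rightarrow> 'f \<Rightarrow> 'a \<Rightarrow> 'a set" where
  "eigenspace scale mult l z = {x. mult z x = scale l x}"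

definition scalar_line ::
    "('f::field \<Rightarrow> 'a::ab_group_add \<Rightarrow> 'a) \<Rightarrow> 'a \<Rightarrow> 'a set" where
  "scalar_line scale c = {scale k c | k. True}"

definition is_direct_sum3 :: "'a::ab_group_add set \<Rightarrow> 'a set \<Rightarrow> 'a set \<Rightarrow> bool" where
  "is_direct_sum3 U V W \<longleftrightarrow> bij_betw (\<lambda>(u, v, w). u + v + w) (U \<times> V \<times> W) UNIV"

definition is_axis ::
    "('f::field \<Rightarrow> 'a::ab_group_add \<Rightarrow> 'a) \<Rightarrow> ('a \<Rightarrow> 'a \<Rightarrow> 'a) \<Rightarrow> ('a \<Rightarrow> 'a \<Rightarrow> 'f) \<Rightarrow> 'a \<Rightarrow> bool" where
  "is_axis scale mult form c \<longleftrightarrow>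
     (let A0 = eigenspace scale mult 0 c; Ah = eigenspace scale mult (1/2) c;
          Fc = scalar_line scale c
      in mult c c = c \<and> form c c = 1 \<and> is_direct_sum3 Fc A0 Ah \<and>
         (\<forall>x\<in>A0. \<forall>y\<in>A0. mult x y \<in> A0) \<and>
         (\<forall>x\<in>A0. \<forall>y\<in>Ah. mult x y \<in> Ah) \<and>
         (\<forall>x\<in>Ah. \<forall>y\<in>Ah. mult x y \<in> {u + v | u v. u \<in> Fc \<and> v \<in> A0}))"

text \<open>
  The components \<open>x\<^sub>0\<close> and \<open>x\<^bsub>1/2\<^esub>\<close> of \<open>x = (a,x)a + x\<^sub>0 + x\<^bsub>1/2\<^esub>\<close>; they are only meaningful when \<open>a\<close>
  is an axis.
\<close>

definition comp_zero ::
    "('f::field \<Rightarrow> 'a::ab_group_add \<Rightarrow> 'a) \<Rightarrow> ('a \<Rightarrow> 'a \<Rightarrow> 'a) \<Rightarrow> ('a \<Rightarrow> 'a \<Rightarrow> 'f) \<Rightarrow> 'a \<Rightarrow> 'a \<Rightarrow> 'a" where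
  "comp_zero scale mult form a x =
     (THE u. u \<in> eigenspace scale mult 0 a \<and>
        (\<exists>v \<in> eigenspace scale mult (1/2) a. x = scale (form a x) a + u + v))"

definition comp_half ::
    "('f::field \<Rightarrow> 'a::ab_group_add \<Rightarrow> 'a) \<Rightarrow> ('a \<Rightarrow> 'a \<Rightarrow> 'a) \<Rightarrow> ('a \<Rightarrow> 'a \<Rightarrow> 'f) \<Rightarrow> 'a \<Rightarrow> 'a \<Rightarrow> 'a" where
  "comp_half scale mult form a x =
     (THE v. v \<in> eigenspace scale mult (1/2) a \<and>
        (\<exists>u \<in> eigenspace scale mult 0 a. x = scale (form a x) a + u + v))"

definition comm_map :: "('a::ab_group_add \<Rightarrow> 'a) \<Rightarrow> ('a \<Rightarrow> 'a) \<Rightarrow> 'a \<Rightarrow> 'a" where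
  "comm_map S T = (\<lambda>y. S (T y) - T (S y))"

definition is_derivation ::
    "('f::field \<Rightarrow> 'a::ab_group_add \<Rightarrow> 'a) \<Rightarrow> ('a \<Rightarrow> 'a \<Rightarrow> 'a) \<Rightarrow> ('a \<Rightarrow> 'a) \<Rightarrow> bool" where
  "is_derivation scale mult D \<longleftrightarrow>
     Vector_Spaces.linear scale scale D \<and> (\<forall>x y. D (mult x y) = mult x (D y) + mult (D x) y)"

end

theory Submission
  imports Defs
begin

text \<open>
  That \<open>c\<close> is an axis amounts to \<open>2c(cx) = cx + (c,x)c\<close> together with the multiplicativity of the Miyamoto
  involution \<open>\<tau>\<^sub>c\<close>, and the latter is an identity quadratic in \<open>c\<close>.  Let \<open>h\<close> be the half component of \<open>b\<close>
  with respect to \<open>a\<close>.  If \<open>(a,b) \<noteq> 1/2\<close>, the identities for the axes \<open>b\<close>, \<open>\<tau>\<^sub>b(a)\<close> and their images under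
  \<open>\<tau>\<^sub>a\<close> combine to \<open>1 - 4(a,b)\<close> times the derivative of the identity for \<open>a\<close> in the direction \<open>h\<close>; hence
  \<open>a + \<epsilon>h\<close> is an axis over the dual numbers, and the infinitesimal part of its involution yields the
  derivation \<open>[L\<^sub>a, L\<^sub>b]\<close>.  If \<open>(a,b) = 1/2\<close>, the automorphism \<open>\<phi> = \<tau>\<^sub>a\<tau>\<^sub>b\<close> has order dividing \<open>4\<close>, and the
  algebra is the direct sum of the subspaces \<open>\<phi> = 1\<close>, \<open>\<phi> = -1\<close> and \<open>\<phi>\<^sup>2 = -1\<close>, on which \<open>[L\<^sub>a, L\<^sub>b]\<close> is zero,
  a rotation of a plane divided by \<open>4\<close>, and \<open>\<phi>/8\<close>; the Leibniz rule is checked on these pieces.  Evaluated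
  on the Peirce components of \<open>a\<close>, the Leibniz rule is (1) and (2).

  Vector identities are verified by applying an arbitrary linear functional, which turns them into
  polynomial identities over the field.
\<close>

section \<open>Linear functionals and the characteristic\<close>

text \<open>A nonzero \<open>v - w\<close> extends to a basis, so some functional takes the value
  \<open>1\<close> on it.\<close>

lemma (in vector_space) eq_if_linear_functionals_eq:
  assumes "\<And>f. Vector_Spaces.linear scale (*) f \<Longrightarrow> f v = f w"
  shows "v = w"
proof (rule ccontr)
  assume ne: "v \<noteq> w"
  interpret F: vector_space "(*) :: 'a \<Rightarrow> 'a \<Rightarrow> 'a"
    by unfold_locales (auto simp: algebra_simps)
  interpret P: vector_space_pair scale "(*) :: 'a \<Rightarrow> 'a \<Rightarrow> 'a" ..
  have "independent {v - w}" using ne by simp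
  then obtain f where f: "Vector_Spaces.linear scale (*) f" "f (v - w) = 1"
    using P.linear_independent_extend[of "{v - w}" "\<lambda>_. 1"] by auto
  have "f (v - w) = f v - f w" using f(1) by (rule P.linear_diff)
  then show False using assms[OF f(1)] f(2) by simp
qed

lemma (in vector_space) linear_functional_simps:
  assumes "Vector_Spaces.linear scale (*) f"
  shows "f (x + y) = f x + f y" "f (x - y) = f x - f y" "f (- x) = - f x"
    "f (scale k x) = k * f x" "f 0 = 0"
proof -
  interpret f: Vector_Spaces.linear scale "(*)" f by fact
  show "f (x + y) = f x + f y" "f (x - y) = f x - f y" "f (- x) = - f x"
    "f (scale k x) = k * f x" "f 0 = 0"
    by (rule f.add f.diff f.neg f.scale f.zero)+
qed

lemma two_neq_0_if_CHAR_neq_2: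
  assumes "CHAR('f::field) \<noteq> 2"
  shows "(2::'f) \<noteq> 0"
proof
  assume "(2::'f) = 0"
  then have "of_nat 2 = (0::'f)" by simp
  then have "CHAR('f) dvd 2" by (simp only: of_nat_eq_0_iff_char_dvd)
  moreover from this have "CHAR('f) \<le> 2" by (rule dvd_imp_le) simp
  ultimately show False
    using assms CHAR_not_1'[where 'a='f] by (cases "CHAR('f)") auto
qed

section \<open>Miyamoto involutions and the Frobenius form\<close>

context frobenius_algebra
begin

notation scale (infixr \<open>*s\<close> 75)

lemma mult_simps:
  "x \<bullet> (y + z) = x \<bullet> y + x \<bullet> z" "(x + y) \<bullet> z = x \<bullet> z + y \<bullet> z"
  "x \<bullet> (y - z) = x \<bullet> y - x \<bullet> z" "(x - y) \<bullet> z = x \<bullet> z - y \<bullet> z"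
  "x \<bullet> (- y) = - (x \<bullet> y)" "(- x) \<bullet> y = - (x \<bullet> y)"
  "x \<bullet> (k *s y) = k *s (x \<bullet> y)" "(k *s x) \<bullet> y = k *s (x \<bullet> y)"
  "x \<bullet> 0 = 0" "0 \<bullet> x = 0"
proof -
  interpret l: Vector_Spaces.linear scale scale "\<lambda>y. x \<bullet> y" for x by (rule mult_linear)
  have r: "x \<bullet> y = y \<bullet> x" for x y by (rule mult_commute)
  show 1: "x \<bullet> (y + z) = x \<bullet> y + x \<bullet> z" "x \<bullet> (y - z) = x \<bullet> y - x \<bullet> z"
    "x \<bullet> (- y) = - (x \<bullet> y)" "x \<bullet> (k *s y) = k *s (x \<bullet> y)" "x \<bullet> 0 = 0" for x y z k
    by (rule l.add l.diff l.neg l.scale l.zero)+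
  show "(x + y) \<bullet> z = x \<bullet> z + y \<bullet> z" "(x - y) \<bullet> z = x \<bullet> z - y \<bullet> z"
    "(- x) \<bullet> y = - (x \<bullet> y)" "(k *s x) \<bullet> y = k *s (x \<bullet> y)" "0 \<bullet> x = 0"
    by (metis r 1)+
qed

lemma form_simps:
  "form x (y + z) = form x y + form x z" "form (x + y) z = form x z + form y z"
  "form x (y - z) = form x y - form x z" "form (x - y) z = form x z - form y z"
  "form x (- y) = - form x y" "form (- x) y = - form x y"
  "form x (k *s y) = k * form x y" "form (k *s x) y = k * form x y"
  "form x 0 = 0" "form 0 x = 0"
proof -
  have r: "form x y = form y x" for x y by (rule form_commute)
  note 1 = linear_functional_simps[OF form_linear]
  show "form x (y + z) = form x y + form x z" "form x (y - z) = form x y - form x z"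
    "form x (- y) = - form x y" "form x (k *s y) = k * form x y" "form x 0 = 0"
    by (rule 1)+
  show "form (x + y) z = form x z + form y z" "form (x - y) z = form x z - form y z"
    "form (- x) y = - form x y" "form (k *s x) y = k * form x y" "form 0 x = 0"
    by (metis r 1)+
qed

lemmas bilinear = mult_simps form_simps

text \<open>For an axis \<open>c\<close> this is \<open>1\<close> on the line of \<open>c\<close>
  and on the eigenvalue \<open>0\<close>, and \<open>-1\<close> on the eigenvalue
  \<open>1/2\<close>, written without reference to components.\<close>

definition miyamoto :: "'a \<Rightarrow> 'a \<Rightarrow> 'a" where
  "miyamoto c x = x - 4 *s (c \<bullet> x) + (4 * form c x) *s c"

text \<open>An equational substitute for \<open>is_axis\<close>: the third conjunct encodes the
  eigenvalues of multiplication by \<open>c\<close>, the fourth the sign grading contained in the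
  fusion rules. Equations are easy to polarize and to transport by automorphisms.\<close>

definition axial :: "'a \<Rightarrow> bool" where
  "axial c \<longleftrightarrow> c \<bullet> c = c \<and> form c c = 1 \<and>
     (\<forall>x. 2 *s (c \<bullet> (c \<bullet> x)) = c \<bullet> x + form c x *s c) \<and>
     (\<forall>x y. miyamoto c (x \<bullet> y) = miyamoto c x \<bullet> miyamoto c y)"

lemma axialD:
  assumes "axial c"
  shows "c \<bullet> c = c" "form c c = 1" "2 *s (c \<bullet> (c \<bullet> x)) = c \<bullet> x + form c x *s c"
    "miyamoto c (x \<bullet> y) = miyamoto c x \<bullet> miyamoto c y"
  using assms by (auto simp: axial_def)

lemma miyamoto_linear: "Vector_Spaces.linear scale scale (miyamoto c)"
  by unfold_locales (simp_all add: miyamoto_def bilinear algebra_simps)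

lemma miyamoto_simps:
  "miyamoto c (x + y) = miyamoto c x + miyamoto c y"
  "miyamoto c (x - y) = miyamoto c x - miyamoto c y"
  "miyamoto c (- x) = - miyamoto c x"
  "miyamoto c (k *s x) = k *s miyamoto c x"
  "miyamoto c 0 = 0"
proof -
  interpret l: Vector_Spaces.linear scale scale "miyamoto c" by (rule miyamoto_linear)
  show "miyamoto c (x + y) = miyamoto c x + miyamoto c y"
    "miyamoto c (x - y) = miyamoto c x - miyamoto c y"
    "miyamoto c (- x) = - miyamoto c x" "miyamoto c (k *s x) = k *s miyamoto c x"
    "miyamoto c 0 = 0"
    by (rule l.add l.diff l.neg l.scale l.zero)+
qed

lemma form_axial_mult: "axial c \<Longrightarrow> form c (c \<bullet> x) = form c x"
  by (simp add: axialD(1) flip: form_assoc)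

lemma miyamoto_self: "axial c \<Longrightarrow> miyamoto c c = c"
  by (simp add: miyamoto_def axialD)

lemma miyamoto_miyamoto:
  assumes c: "axial c"
  shows "miyamoto c (miyamoto c x) = x"
proof (rule eq_if_linear_functionals_eq)
  fix f assume "Vector_Spaces.linear scale (*) f"
  note lin = linear_functional_simps[OF this]
  show "f (miyamoto c (miyamoto c x)) = f x"
    using arg_cong[OF axialD(3)[OF c, of x], of f]
    unfolding miyamoto_def bilinear lin form_axial_mult[OF c] axialD(1,2)[OF c]
    by algebra
qed

text \<open>Multiplication by \<open>c\<close> and the rank-one map \<open>form c x *s c\<close> are
  self-adjoint, hence so is \<open>miyamoto c\<close>; a self-adjoint involution is an
  isometry.\<close>

lemma form_miyamoto:
  assumes c: "axial c"
  shows "form (miyamoto c x) (miyamoto c y) = form x y"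
proof -
  have 1: "form (c \<bullet> x) (c \<bullet> y) = form x (c \<bullet> (c \<bullet> y))"
    by (metis form_assoc mult_commute)
  have 2: "form (c \<bullet> x) y = form x (c \<bullet> y)"
    by (metis form_assoc mult_commute)
  have 3: "form (c \<bullet> x) c = form c x"
    by (metis form_axial_mult[OF c] form_commute)
  have "2 * form x (c \<bullet> (c \<bullet> y)) = form x (c \<bullet> y) + form c y * form c x"
    using arg_cong[OF axialD(3)[OF c, of y], of "form x"]
    by (simp add: bilinear form_commute[of x c])
  then show ?thesis
    unfolding miyamoto_def bilinear form_axial_mult[OF c] axialD(1,2)[OF c]
      form_commute[of x c] 1 2 3
    by algebra
qed

lemma form_miyamoto_left:
  assumes "axial c"
  shows "form (miyamoto c x) y = form x (miyamoto c y)"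
  by (metis assms form_miyamoto miyamoto_miyamoto)

end

section \<open>Identities for axes in characteristic other than two\<close>

locale frobenius_algebra_odd = frobenius_algebra scale mult form
  for scale :: "'f::field \<Rightarrow> 'a::ab_group_add \<Rightarrow> 'a" (infixr \<open>*s\<close> 75)
    and mult :: "'a \<Rightarrow> 'a \<Rightarrow> 'a"  (infixl \<open>\<bullet>\<close> 70)
    and form :: "'a \<Rightarrow> 'a \<Rightarrow> 'f" +
  assumes two_neq_0: "(2::'f) \<noteq> 0"
begin

lemma field_cancel_2: "(2::'f) * x = 2 * y \<Longrightarrow> x = y"
  using two_neq_0 by simp

lemma four_neq_0: "(4::'f) \<noteq> 0"
  using two_neq_0 by (metis mult_2_right mult_eq_0_iff numeral_Bit0 numeral_times_numeral)

lemma field_cancel_4: "(4::'f) * x = 4 * y \<Longrightarrow> x = y"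
  using four_neq_0 by simp

text \<open>Multiplicativity of \<open>miyamoto c\<close> is expanded and its terms of higher degree
  in \<open>c\<close> are removed by \<open>axialD(3)\<close>. What remains has degree at most two
  in \<open>c\<close>, so it splits into an even and an odd part when \<open>c\<close> is replaced
  by a sum or a difference.\<close>

lemma axial_mult_mult:
  assumes c: "axial c"
  shows "c \<bullet> (x \<bullet> y) + 4 *s ((c \<bullet> x) \<bullet> (c \<bullet> y)) =
    x \<bullet> (c \<bullet> y) + y \<bullet> (c \<bullet> x) + form c y *s (c \<bullet> x) + form c x *s (c \<bullet> y) + form c (x \<bullet> y) *s c"
proof (rule eq_if_linear_functionals_eq, rule field_cancel_4)
  fix f assume "Vector_Spaces.linear scale (*) f"
  note lin = linear_functional_simps[OF this]
  have comm: "(c \<bullet> x) \<bullet> c = c \<bullet> (c \<bullet> x)" "(c \<bullet> x) \<bullet> y = y \<bullet> (c \<bullet> x)" "x \<bullet> c = c \<bullet> x"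
    by (rule mult_commute)+
  show "4 * f (c \<bullet> (x \<bullet> y) + 4 *s ((c \<bullet> x) \<bullet> (c \<bullet> y))) =
    4 * f (x \<bullet> (c \<bullet> y) + y \<bullet> (c \<bullet> x) + form c y *s (c \<bullet> x) + form c x *s (c \<bullet> y) + form c (x \<bullet> y) *s c)"
    using arg_cong[OF axialD(3)[OF c, of x], of f] arg_cong[OF axialD(3)[OF c, of y], of f]
      arg_cong[OF axialD(4)[OF c, of x y], of f]
    unfolding miyamoto_def bilinear lin comm axialD(1,2)[OF c]
    by algebra
qed

text \<open>With \<open>z\<close> as first factor in \<open>axial_mult_mult\<close>, every term
  containing \<open>c \<bullet> z\<close>, \<open>form c z\<close> or
  \<open>form c (z \<bullet> y)\<close> vanishes. For axial algebras this is known as the Seress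
  lemma.\<close>

lemma axial_mult_commute:
  assumes "axial c" "c \<bullet> z = 0"
  shows "c \<bullet> (z \<bullet> y) = z \<bullet> (c \<bullet> y)"
proof -
  have "form c z = 0" using assms axialD(1) by (metis form_assoc form_simps(9))
  moreover have "form c (z \<bullet> y) = 0" using assms by (metis form_assoc form_simps(10))
  ultimately show ?thesis
    using axial_mult_mult[OF assms(1), of z y] assms(2) by (simp add: bilinear)
qed

text \<open>\<open>miyamoto c\<close> is an automorphism preserving the form, so it carries axes to
  axes and conjugates their involutions.\<close>

lemma axial_miyamoto:
  assumes c: "axial c" and d: "axial d"
  shows "axial (miyamoto c d)"
    and "miyamoto (miyamoto c d) x = miyamoto c (miyamoto d (miyamoto c x))"
proof -
  let ?g = "miyamoto c"
  have ml: "?g d \<bullet> x = ?g (d \<bullet> ?g x)" for x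
    by (simp add: axialD(4)[OF c] miyamoto_miyamoto[OF c])
  have fl: "form (?g d) x = form d (?g x)" for x
    by (rule form_miyamoto_left[OF c])
  show t: "miyamoto (?g d) x = ?g (miyamoto d (?g x))" for x
    unfolding miyamoto_def[of "?g d"] miyamoto_def[of d]
    by (simp add: ml fl miyamoto_simps miyamoto_miyamoto[OF c])
  show "axial (?g d)"
    unfolding axial_def t
  proof (intro conjI allI)
    fix x y
    show "?g d \<bullet> ?g d = ?g d" "form (?g d) (?g d) = 1"
      using axialD(1,2)[OF d] by (simp_all add: ml fl miyamoto_miyamoto[OF c])
    show "2 *s (?g d \<bullet> (?g d \<bullet> x)) = ?g d \<bullet> x + form (?g d) x *s ?g d"
      using axialD(3)[OF d, of "?g x"]
      by (simp add: ml fl miyamoto_miyamoto[OF c] flip: miyamoto_simps)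
    show "?g (miyamoto d (?g (x \<bullet> y))) = ?g (miyamoto d (?g x)) \<bullet> ?g (miyamoto d (?g y))"
      by (simp add: axialD(4)[OF c] axialD(4)[OF d])
  qed
qed

text \<open>Supplies one half as a variable with a polynomial equation, the shape that
  \<open>algebra\<close> can use.\<close>

lemma exists_half: "\<exists>t::'f. 2 * t = 1"
  using two_neq_0 by (intro exI[of _ "1/2"]) simp

lemma cancel_2: "2 *s x = 2 *s y \<longleftrightarrow> x = y"
  using two_neq_0 by simp

lemma scale_double: "(2 * k) *s x = k *s x + k *s x"
  by (metis mult_2 scale_left_distrib)

lemma scale_2: "2 *s x = x + x"
  using scale_double[of 1 x] by simp

section \<open>Eigenspaces and Peirce components\<close>

lemma eigenspace_zero_iff: "x \<in> eigenspace scale mult 0 c \<longleftrightarrow> c \<bullet> x = 0"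
  by (simp add: eigenspace_def)

lemma eigenspace_half_iff: "x \<in> eigenspace scale mult (1/2) c \<longleftrightarrow> 2 *s (c \<bullet> x) = x"
proof -
  have "2 *s (c \<bullet> x) = 2 *s ((1/2) *s x) \<longleftrightarrow> c \<bullet> x = (1/2) *s x" by (rule cancel_2)
  then show ?thesis using two_neq_0 by (simp add: eigenspace_def)
qed

lemma form_eigenvector_zero:
  assumes "c \<bullet> c = c" "c \<bullet> x = 0"
  shows "form c x = 0"
  using form_assoc[of c c x] assms by (simp add: bilinear)

lemma form_eigenvector_half:
  assumes "c \<bullet> c = c" "2 *s (c \<bullet> x) = x"
  shows "form c x = 0"
proof -
  have "2 * form c x = 2 * form (c \<bullet> c) x" using assms(1) by simp
  also have "\<dots> = form c (2 *s (c \<bullet> x))" by (simp only: form_assoc bilinear)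
  also have "\<dots> = form c x" using assms(2) by simp
  finally show ?thesis by (metis mult_2 add_cancel_right_left)
qed

lemma miyamoto_eigenvector_zero:
  assumes "c \<bullet> c = c" "c \<bullet> x = 0"
  shows "miyamoto c x = x"
  by (simp add: miyamoto_def assms form_eigenvector_zero)

lemma miyamoto_eigenvector_half:
  assumes "c \<bullet> c = c" "2 *s (c \<bullet> x) = x"
  shows "miyamoto c x = - x"
proof -
  have "4 *s (c \<bullet> x) = (2 * 2) *s (c \<bullet> x)" by simp
  also have "\<dots> = x + x" using assms(2) scale_left_distrib[of 1 1 x]
    by (simp only: flip: scale_scale) simp
  finally show ?thesis
    using form_eigenvector_half[OF assms] by (simp add: miyamoto_def)
qed

text \<open>Both equations are checked on the components \<open>k *s c + u + v\<close>. For the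
  multiplicativity, the fusion rules say that the product respects the signs that
  \<open>miyamoto c\<close> assigns to the components.\<close>

lemma is_axis_imp_axial:
  assumes ax: "is_axis scale mult form c"
  shows "axial c"
proof -
  have cc: "c \<bullet> c = c" "form c c = 1"
    and sum: "is_direct_sum3 (scalar_line scale c) (eigenspace scale mult 0 c)
      (eigenspace scale mult (1/2) c)"
    and zz: "\<And>x y. c \<bullet> x = 0 \<Longrightarrow> c \<bullet> y = 0 \<Longrightarrow> c \<bullet> (x \<bullet> y) = 0"
    and zh: "\<And>x y. c \<bullet> x = 0 \<Longrightarrow> 2 *s (c \<bullet> y) = y \<Longrightarrow> 2 *s (c \<bullet> (x \<bullet> y)) = x \<bullet> y"
    and hh: "\<And>x y. 2 *s (c \<bullet> x) = x \<Longrightarrow> 2 *s (c \<bullet> y) = y \<Longrightarrow>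
      \<exists>u w. x \<bullet> y = u + w \<and> (\<exists>k. u = k *s c) \<and> c \<bullet> w = 0"
    using ax unfolding is_axis_def Let_def
    by (auto simp: eigenspace_zero_iff eigenspace_half_iff Ball_def scalar_line_def)
  have dec: "\<exists>k u v. x = k *s c + u + v \<and> c \<bullet> u = 0 \<and> 2 *s (c \<bullet> v) = v" for x
  proof -
    have "x \<in> (\<lambda>(u, v, w). u + v + w) ` (scalar_line scale c \<times> eigenspace scale mult 0 c \<times>
      eigenspace scale mult (1/2) c)"
      using sum unfolding is_direct_sum3_def by (auto simp: bij_betw_def)
    then show ?thesis
      by (auto simp: scalar_line_def eigenspace_zero_iff eigenspace_half_iff) blast
  qed
  show ?thesis
    unfolding axial_def
  proof (intro conjI allI)
    show "c \<bullet> c = c" "form c c = 1" by fact+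
  next
    fix x
    obtain k u v where x: "x = k *s c + u + v" "c \<bullet> u = 0" "2 *s (c \<bullet> v) = v"
      using dec by blast
    have "form c u = 0" "form c v = 0"
      using x cc by (auto intro: form_eigenvector_zero form_eigenvector_half)
    moreover have "2 *s (c \<bullet> (c \<bullet> v)) = c \<bullet> v"
      using arg_cong[OF x(3), of "\<lambda>t. c \<bullet> t"] by (simp add: bilinear)
    moreover have "k *s c + k *s c = (2 * k) *s c"
      by (simp only: scale_double)
    ultimately show "2 *s (c \<bullet> (c \<bullet> x)) = c \<bullet> x + form c x *s c"
      unfolding x(1) by (simp add: bilinear cc x(2) scale_right_distrib)
  next
    fix x y
    obtain k u v where x: "x = k *s c + u + v" "c \<bullet> u = 0" "2 *s (c \<bullet> v) = v"
      using dec by blast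
    obtain l u' v' where y: "y = l *s c + u' + v'" "c \<bullet> u' = 0" "2 *s (c \<bullet> v') = v'"
      using dec by blast
    have cu: "u \<bullet> c = 0" "u' \<bullet> c = 0" using x(2) y(2) by (metis mult_commute)+
    have vc: "v \<bullet> c = c \<bullet> v" by (rule mult_commute)
    have cv: "2 *s (c \<bullet> (c \<bullet> v)) = c \<bullet> v" "2 *s (c \<bullet> (c \<bullet> v')) = c \<bullet> v'"
      using arg_cong[OF x(3), of "\<lambda>t. c \<bullet> t"] arg_cong[OF y(3), of "\<lambda>t. c \<bullet> t"]
      by (simp_all add: bilinear)
    have c: "miyamoto c c = c" by (simp add: miyamoto_def cc)
    note zero = miyamoto_eigenvector_zero[OF cc(1)] and half = miyamoto_eigenvector_half[OF cc(1)]
    have vu': "miyamoto c (v \<bullet> u') = - (v \<bullet> u')"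
      using half[OF zh[OF y(2) x(3)]] by (simp only: mult_commute)
    obtain m w where "v \<bullet> v' = m *s c + w" "c \<bullet> w = 0" using hh[OF x(3) y(3)] by blast
    then have vv': "miyamoto c (v \<bullet> v') = v \<bullet> v'" by (simp add: miyamoto_simps c zero)
    show "miyamoto c (x \<bullet> y) = miyamoto c x \<bullet> miyamoto c y"
      unfolding x(1) y(1)
      by (simp add: bilinear miyamoto_simps cc c x(2) y(2) zero half[OF x(3)] half[OF y(3)] cu vc
          zero[OF zz[OF x(2) y(2)]] half[OF zh[OF x(2) y(3)]] half[OF cv(1)] half[OF cv(2)]
          vu' vv')
  qed
qed

text \<open>Both factors are negated by \<open>miyamoto c\<close>, so their product is fixed, and a
  fixed vector \<open>w\<close> satisfies \<open>c \<bullet> w = form c w *s c\<close>.\<close>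

lemma axial_mult_half_half:
  assumes c: "axial c" and x: "2 *s (c \<bullet> x) = x" and y: "2 *s (c \<bullet> y) = y"
  shows "c \<bullet> (x \<bullet> y) = form c (x \<bullet> y) *s c"
proof -
  note cc = axialD(1)[OF c]
  have "miyamoto c (x \<bullet> y) = x \<bullet> y"
    by (simp add: axialD(4)[OF c] miyamoto_eigenvector_half[OF cc x]
        miyamoto_eigenvector_half[OF cc y] bilinear)
  then have "4 *s (c \<bullet> (x \<bullet> y)) = 4 *s (form c (x \<bullet> y) *s c)"
    by (simp add: miyamoto_def algebra_simps)
  then show ?thesis using four_neq_0 by (simp only: scale_cancel_left) simp
qed

text \<open>The map taking \<open>x\<close> to
  \<open>2 *s (c \<bullet> x) - (2 * form c x) *s c\<close> kills \<open>c\<close> and the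
  eigenvalue \<open>0\<close>: it is the projection to the eigenvalue \<open>1/2\<close>.\<close>

lemma axial_half_part:
  assumes "axial c"
  shows "2 *s (c \<bullet> (2 *s (c \<bullet> x) - (2 * form c x) *s c)) = 2 *s (c \<bullet> x) - (2 * form c x) *s c"
proof (rule eq_if_linear_functionals_eq)
  fix f assume "Vector_Spaces.linear scale (*) f"
  note lin = linear_functional_simps[OF this]
  show "f (2 *s (c \<bullet> (2 *s (c \<bullet> x) - (2 * form c x) *s c)))
    = f (2 *s (c \<bullet> x) - (2 * form c x) *s c)"
    using arg_cong[OF axialD(3)[OF assms, of x], of f]
    unfolding bilinear lin axialD(1,2)[OF assms] by algebra
qed

lemma axial_zero_part:
  assumes "axial c"
  shows "c \<bullet> (x + form c x *s c - 2 *s (c \<bullet> x)) = 0"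
  using axialD(3)[OF assms, of x] by (simp add: bilinear axialD(1)[OF assms])

text \<open>Uniqueness for the definite description comes from applying
  \<open>2 *s (c \<bullet> _)\<close> to a decomposition of \<open>x\<close>, which isolates
  \<open>v\<close>.\<close>

lemma comp_half_eq:
  assumes c: "axial c"
  shows "comp_half scale mult form c x = 2 *s (c \<bullet> x) - (2 * form c x) *s c"
  unfolding comp_half_def eigenspace_zero_iff eigenspace_half_iff Bex_def
proof (rule the_equality, intro conjI exI)
  show "2 *s (c \<bullet> (2 *s (c \<bullet> x) - (2 * form c x) *s c)) = 2 *s (c \<bullet> x) - (2 * form c x) *s c"
    by (rule axial_half_part[OF c])
  show "c \<bullet> (x + form c x *s c - 2 *s (c \<bullet> x)) = 0"
    by (rule axial_zero_part[OF c])
  show "x = form c x *s c + (x + form c x *s c - 2 *s (c \<bullet> x)) +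
    (2 *s (c \<bullet> x) - (2 * form c x) *s c)"
    by (simp add: scale_double)
next
  fix v assume "2 *s (c \<bullet> v) = v \<and> (\<exists>u. c \<bullet> u = 0 \<and> x = form c x *s c + u + v)"
  then obtain u where v: "2 *s (c \<bullet> v) = v" and u: "c \<bullet> u = 0" "x = form c x *s c + u + v"
    by blast
  have "2 *s (c \<bullet> x) = (2 * form c x) *s c + v"
    using arg_cong[OF u(2), of "\<lambda>t. 2 *s (c \<bullet> t)"] v u(1)
    by (simp add: bilinear axialD(1)[OF c] scale_right_distrib)
  then show "v = 2 *s (c \<bullet> x) - (2 * form c x) *s c" by simp
qed

lemma comp_zero_eq:
  assumes c: "axial c"
  shows "comp_zero scale mult form c x = x + form c x *s c - 2 *s (c \<bullet> x)"
  unfolding comp_zero_def eigenspace_zero_iff eigenspace_half_iff Bex_def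
proof (rule the_equality, intro conjI exI)
  show "2 *s (c \<bullet> (2 *s (c \<bullet> x) - (2 * form c x) *s c)) = 2 *s (c \<bullet> x) - (2 * form c x) *s c"
    by (rule axial_half_part[OF c])
  show "c \<bullet> (x + form c x *s c - 2 *s (c \<bullet> x)) = 0"
    by (rule axial_zero_part[OF c])
  show "x = form c x *s c + (x + form c x *s c - 2 *s (c \<bullet> x)) +
    (2 *s (c \<bullet> x) - (2 * form c x) *s c)"
    by (simp add: scale_double)
next
  fix u assume "c \<bullet> u = 0 \<and> (\<exists>v. 2 *s (c \<bullet> v) = v \<and> x = form c x *s c + u + v)"
  then obtain v where v: "2 *s (c \<bullet> v) = v" and u: "c \<bullet> u = 0" "x = form c x *s c + u + v"
    by blast
  have "2 *s (c \<bullet> x) = (2 * form c x) *s c + v"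
    using arg_cong[OF u(2), of "\<lambda>t. 2 *s (c \<bullet> t)"] v u(1)
    by (simp add: bilinear axialD(1)[OF c] scale_right_distrib)
  then have "x + form c x *s c - 2 *s (c \<bullet> x) = x - form c x *s c - v"
    by (simp add: scale_double)
  moreover have "u = x - form c x *s c - v"
    using u(2)[symmetric] by (simp only: eq_diff_eq ac_simps)
  ultimately show "u = x + form c x *s c - 2 *s (c \<bullet> x)" by simp
qed

text \<open>This is \<open>axialD(3)\<close> differentiated at \<open>c\<close> in the direction
  \<open>h\<close>. It is \<open>axial_mult_mult\<close> with \<open>h\<close> as first factor,
  where \<open>c \<bullet> h\<close> is half of \<open>h\<close>.\<close>

lemma axial_half_polarized:
  assumes c: "axial c" and h: "2 *s (c \<bullet> h) = h"
  shows "2 *s (h \<bullet> (c \<bullet> x) + c \<bullet> (h \<bullet> x)) = h \<bullet> x + form h x *s c + form c x *s h"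
proof (rule eq_if_linear_functionals_eq, rule field_cancel_2)
  fix f assume "Vector_Spaces.linear scale (*) f"
  note lin = linear_functional_simps[OF this]
  have ch: "form c h = 0" by (rule form_eigenvector_half[OF axialD(1)[OF c] h])
  have 1: "2 * form c (h \<bullet> x) = form h x"
    using h by (metis form_assoc form_simps(8))
  have 2: "x \<bullet> (c \<bullet> h) = (c \<bullet> h) \<bullet> x" by (rule mult_commute)
  have 3: "2 * f ((c \<bullet> h) \<bullet> (c \<bullet> x)) = f (h \<bullet> (c \<bullet> x))" "2 * f ((c \<bullet> h) \<bullet> x) = f (h \<bullet> x)"
    "2 * f (c \<bullet> h) = f h"
    using h by (metis lin(4) mult_simps(8))+ 
  show "2 * f (2 *s (h \<bullet> (c \<bullet> x) + c \<bullet> (h \<bullet> x))) =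
    2 * f (h \<bullet> x + form h x *s c + form c x *s h)"
    using arg_cong[OF axial_mult_mult[OF c, of h x], of f] 1 3
    unfolding bilinear lin ch 2 by algebra
qed

text \<open>\<open>b\<close> differs from \<open>h\<close> by a multiple of \<open>a\<close> and a
  vector annihilated by \<open>a\<close>; multiplication by either commutes with multiplication by
  \<open>a\<close>.\<close>

lemma comm_map_eq_half_part:
  fixes a b
  assumes a: "axial a"
  defines "h \<equiv> 2 *s (a \<bullet> b) - (2 * form a b) *s a"
  shows "comm_map (mult a) (mult b) = comm_map (mult a) (mult h)"
proof
  fix x
  define z where "z = b + form a b *s a - 2 *s (a \<bullet> b)"
  have b: "b = form a b *s a + z + h" by (simp add: z_def h_def scale_double)
  have "a \<bullet> z = 0" unfolding z_def by (rule axial_zero_part[OF a])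
  then show "comm_map (mult a) (mult b) x = comm_map (mult a) (mult h) x"
    by (subst b) (simp add: comm_map_def bilinear axial_mult_commute[OF a])
qed

subsection \<open>Infinitesimal axes\<close>

text \<open>The part of the identity \<open>axial_mult_mult\<close> for \<open>g + h\<close> that is odd in \<open>h\<close>.\<close>
definition axial_defect :: "'a \<Rightarrow> 'a \<Rightarrow> 'a \<Rightarrow> 'a \<Rightarrow> 'a" where
  "axial_defect g h x y = h \<bullet> (x \<bullet> y) + 4 *s ((g \<bullet> x) \<bullet> (h \<bullet> y) + (h \<bullet> x) \<bullet> (g \<bullet> y))
    - x \<bullet> (h \<bullet> y) - y \<bullet> (h \<bullet> x) - form g y *s (h \<bullet> x) - form h y *s (g \<bullet> x)
    - form g x *s (h \<bullet> y) - form h x *s (g \<bullet> y) - form h (x \<bullet> y) *s g - form g (x \<bullet> y) *s h"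

text \<open>
  The vanishing of the defect for \<open>g = a\<close> says that \<open>a + \<epsilon>h\<close> is an axis over the dual numbers; up to a factor
  \<open>8\<close> the derivation is the infinitesimal part of \<open>\<tau>\<^sub>a\<tau>\<close>, with \<open>\<tau>\<close> the Miyamoto involution of \<open>a + \<epsilon>h\<close>.
\<close>
lemma derivation_if_infinitesimal_axis:
  assumes a: "axial a" and h: "2 *s (a \<bullet> h) = h"
    and G: "\<And>x y. axial_defect a h x y = 0"
  shows "comm_map (mult a) (mult h) (x \<bullet> y) =
    x \<bullet> comm_map (mult a) (mult h) y + comm_map (mult a) (mult h) x \<bullet> y"
proof -
  note aa = axialD(1,2)[OF a]
  have ah: "form a h = 0" by (rule form_eigenvector_half[OF aa(1) h])
  have fh: "2 * form a (h \<bullet> x) = form h x" for x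
    using h by (metis form_assoc form_simps(8))
  \<comment> \<open>Up to the factor \<open>-4\<close>, this is the coefficient of \<epsilon> in the
    Miyamoto involution of \<open>a + \<epsilon>h\<close>.\<close>
  define E where "E x = h \<bullet> x - form h x *s a - form a x *s h" for x
  have tE: "- miyamoto a (E x) = 2 *s comm_map (mult a) (mult h) x" for x
  proof (rule eq_if_linear_functionals_eq)
    fix f assume "Vector_Spaces.linear scale (*) f"
    note lin = linear_functional_simps[OF this]
    obtain t :: 'f where "2 * t = 1" using exists_half by blast
    moreover have "2 * f (a \<bullet> h) = f h" using h by (metis lin(4))
    ultimately show "f (- miyamoto a (E x)) = f (2 *s comm_map (mult a) (mult h) x)"
      using arg_cong[OF axial_half_polarized[OF a h, of x], of f] fh[of x]
      unfolding miyamoto_def comm_map_def E_def bilinear lin aa ah by algebra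
  qed
  \<comment> \<open>The \<epsilon>-part of multiplicativity: a Leibniz rule twisted by
    \<open>miyamoto a\<close>. Applying \<open>miyamoto a\<close> once more removes the
    twist.\<close>
  have E: "E (x \<bullet> y) = miyamoto a x \<bullet> E y + E x \<bullet> miyamoto a y" for x y
  proof (rule eq_if_linear_functionals_eq)
    fix f assume "Vector_Spaces.linear scale (*) f"
    note lin = linear_functional_simps[OF this]
    have comm: "x \<bullet> a = a \<bullet> x" "x \<bullet> h = h \<bullet> x" "(h \<bullet> x) \<bullet> a = a \<bullet> (h \<bullet> x)"
      "(a \<bullet> x) \<bullet> a = a \<bullet> (a \<bullet> x)" "(a \<bullet> x) \<bullet> h = h \<bullet> (a \<bullet> x)" "h \<bullet> a = a \<bullet> h"
      "(h \<bullet> x) \<bullet> y = y \<bullet> (h \<bullet> x)"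
      by (rule mult_commute)+
    obtain t :: 'f where "2 * t = 1" using exists_half by blast
    moreover have "2 * f (a \<bullet> h) = f h" using h by (metis lin(4))
    ultimately show "f (E (x \<bullet> y)) = f (miyamoto a x \<bullet> E y + E x \<bullet> miyamoto a y)"
      using arg_cong[OF axial_half_polarized[OF a h, of x], of f]
        arg_cong[OF axial_half_polarized[OF a h, of y], of f]
        arg_cong[OF axialD(3)[OF a, of x], of f] arg_cong[OF axialD(3)[OF a, of y], of f]
        arg_cong[OF G[of x y], of f]
      unfolding miyamoto_def E_def axial_defect_def bilinear lin aa comm by algebra
  qed
  have "miyamoto a (E (x \<bullet> y)) = x \<bullet> miyamoto a (E y) + miyamoto a (E x) \<bullet> y"
    by (simp add: E axialD(4)[OF a] miyamoto_simps miyamoto_miyamoto[OF a])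
  then have "- miyamoto a (E (x \<bullet> y)) = x \<bullet> (- miyamoto a (E y)) + (- miyamoto a (E x)) \<bullet> y"
    by (simp add: bilinear)
  then have "2 *s comm_map (mult a) (mult h) (x \<bullet> y) =
    2 *s (x \<bullet> comm_map (mult a) (mult h) y + comm_map (mult a) (mult h) x \<bullet> y)"
    by (simp only: tE bilinear scale_right_distrib)
  then show ?thesis by (simp only: cancel_2)
qed

section \<open>The Leibniz rule evaluated on Peirce components\<close>

text \<open>Twice the derivation sends \<open>x\<close> with eigenvalue \<open>1/2\<close> to
  \<open>form h x *s a - h \<bullet> x\<close>, and \<open>y\<close> with eigenvalue
  \<open>0\<close> to \<open>h \<bullet> y\<close>. Substituting these values into the Leibniz rule
  for \<open>x \<bullet> y\<close> gives the two identities.\<close>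

lemma
  fixes a b
  assumes a: "axial a"
    and der: "is_derivation scale mult (comm_map (mult a) (mult b))"
  defines "h \<equiv> 2 *s (a \<bullet> b) - (2 * form a b) *s a"
  shows derivation_half_half: "\<lbrakk>2 *s (a \<bullet> x) = x; 2 *s (a \<bullet> y) = y\<rbrakk> \<Longrightarrow>
      2 *s (h \<bullet> (x \<bullet> y) + (h \<bullet> x) \<bullet> y + (h \<bullet> y) \<bullet> x) =
        form b y *s x + form b x *s y + (2 * form a (x \<bullet> y)) *s h"
    and derivation_half_zero: "\<lbrakk>2 *s (a \<bullet> x) = x; a \<bullet> y = 0\<rbrakk> \<Longrightarrow>
      h \<bullet> (x \<bullet> y) = (h \<bullet> x) \<bullet> y - (h \<bullet> y) \<bullet> x + form h (x \<bullet> y) *s a"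
proof -
  note aa = axialD(1,2)[OF a]
  have h: "2 *s (a \<bullet> h) = h" unfolding h_def by (rule axial_half_part[OF a])
  have ah: "form a h = 0" "form h a = 0"
    using form_eigenvector_half[OF aa(1) h] form_commute by simp_all
  define D where "D x = a \<bullet> (h \<bullet> x) - h \<bullet> (a \<bullet> x)" for x
  have D: "D (x \<bullet> y) = x \<bullet> D y + D x \<bullet> y" for x y
    using der unfolding is_derivation_def comm_map_eq_half_part[OF a, of b] h_def[symmetric]
    by (simp add: comm_map_def D_def)
  have D_half: "2 *s D x = form h x *s a - h \<bullet> x" if x: "2 *s (a \<bullet> x) = x" for x
  proof -
    have "form a (h \<bullet> x) *s (2 *s a) = form h x *s a"
      using h by (metis form_assoc form_simps(8) scale_scale mult.commute)
    moreover have "2 *s (h \<bullet> (a \<bullet> x)) = h \<bullet> x" using x by (metis mult_simps(7))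
    ultimately show ?thesis
      using axial_mult_half_half[OF a h x] unfolding D_def
      by (simp add: scale_right_diff_distrib mult.commute)
  qed
  {
    assume x: "2 *s (a \<bullet> x) = x" and y: "2 *s (a \<bullet> y) = y"
    \<comment> \<open>Different Peirce components are orthogonal, so only the half part of
      \<open>b\<close> pairs with \<open>x\<close>.\<close>
    have fb: "form b x = form h x" if "2 *s (a \<bullet> x) = x" for x
    proof -
      have "form h x = form b (2 *s (a \<bullet> x))"
        unfolding h_def form_simps form_eigenvector_half[OF aa(1) that]
        by (simp add: form_assoc[symmetric] mult_commute)
      then show ?thesis using that by simp
    qed
    have axy: "a \<bullet> (x \<bullet> y) = form a (x \<bullet> y) *s a" by (rule axial_mult_half_half[OF a x y])
    \<comment> \<open>Multiplication by \<open>a\<close> is moved across the form onto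
      \<open>x \<bullet> y\<close>, where it yields a multiple of \<open>a\<close>, which is
      orthogonal to \<open>h\<close>.\<close>
    have "form h (x \<bullet> y) = form (2 *s (a \<bullet> h)) (x \<bullet> y)" using h by simp
    also have "\<dots> = 2 * form h (a \<bullet> (x \<bullet> y))"
      by (simp add: form_simps) (metis form_assoc mult_commute)
    finally have hxy: "form h (x \<bullet> y) = 0" by (simp add: axy bilinear ah)
    show "2 *s (h \<bullet> (x \<bullet> y) + (h \<bullet> x) \<bullet> y + (h \<bullet> y) \<bullet> x) =
        form b y *s x + form b x *s y + (2 * form a (x \<bullet> y)) *s h"
      unfolding fb[OF x] fb[OF y]
    proof (rule eq_if_linear_functionals_eq)
      fix f assume "Vector_Spaces.linear scale (*) f"
      note lin = linear_functional_simps[OF this]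
      have comm: "h \<bullet> a = a \<bullet> h" "x \<bullet> a = a \<bullet> x" "x \<bullet> (h \<bullet> y) = (h \<bullet> y) \<bullet> x"
        by (rule mult_commute)+
      have e: "f x = 2 * f (a \<bullet> x)" "f y = 2 * f (a \<bullet> y)" "f h = 2 * f (a \<bullet> h)"
        using x y h by (metis lin(4))+
      have "f ((h \<bullet> y) \<bullet> x) = form h y * f (a \<bullet> x) - 2 * f (x \<bullet> D y)"
        using arg_cong[OF D_half[OF y], of "\<lambda>t. f (x \<bullet> t)"] unfolding bilinear lin comm by simp
      moreover have "f ((h \<bullet> x) \<bullet> y) = form h x * f (a \<bullet> y) - 2 * f (D x \<bullet> y)"
        using arg_cong[OF D_half[OF x], of "\<lambda>t. f (t \<bullet> y)"] unfolding bilinear lin comm by simp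
      moreover have "f (h \<bullet> (x \<bullet> y)) =
          2 * f (x \<bullet> D y) + 2 * f (D x \<bullet> y) + 2 * form a (x \<bullet> y) * f (a \<bullet> h)"
      proof -
        have "f (D (x \<bullet> y)) = f (a \<bullet> (h \<bullet> (x \<bullet> y))) - form a (x \<bullet> y) * f (a \<bullet> h)"
          unfolding D_def axy bilinear lin comm ..
        moreover have "f (D (x \<bullet> y)) = f (x \<bullet> D y) + f (D x \<bullet> y)" by (simp add: D lin)
        ultimately show ?thesis
          using arg_cong[OF axial_half_polarized[OF a h, of "x \<bullet> y"], of f]
          unfolding axy hxy bilinear lin comm e by algebra
      qed
      ultimately show "f (2 *s (h \<bullet> (x \<bullet> y) + (h \<bullet> x) \<bullet> y + (h \<bullet> y) \<bullet> x)) =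
          f (form h y *s x + form h x *s y + (2 * form a (x \<bullet> y)) *s h)"
        unfolding lin e by algebra
    qed
  }
  {
    assume x: "2 *s (a \<bullet> x) = x" and y: "a \<bullet> y = 0"
    have xy: "2 *s (a \<bullet> (x \<bullet> y)) = x \<bullet> y"
      using axial_mult_commute[OF a y, of x] x by (metis mult_commute mult_simps(7))
    have ya: "y \<bullet> a = 0" using y by (metis mult_commute)
    have "form h y = form (2 *s (a \<bullet> h)) y" using h by simp
    also have "\<dots> = 2 * form h (a \<bullet> y)"
      by (simp add: form_simps) (metis form_assoc mult_commute)
    finally have "form h y = 0" by (simp add: y bilinear)
    then have Dy: "2 *s D y = h \<bullet> y"
      using axial_half_polarized[OF a h, of y] y form_eigenvector_zero[OF aa(1) y]
      by (simp add: D_def bilinear)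
    show "h \<bullet> (x \<bullet> y) = (h \<bullet> x) \<bullet> y - (h \<bullet> y) \<bullet> x + form h (x \<bullet> y) *s a"
    proof (rule eq_if_linear_functionals_eq)
      fix f assume "Vector_Spaces.linear scale (*) f"
      note lin = linear_functional_simps[OF this]
      have comm: "x \<bullet> (h \<bullet> y) = (h \<bullet> y) \<bullet> x" "a \<bullet> y = 0"
        by (rule mult_commute y)+
      have "f ((h \<bullet> y) \<bullet> x) = 2 * f (x \<bullet> D y)"
        using arg_cong[OF Dy, of "\<lambda>t. f (x \<bullet> t)"] unfolding bilinear lin comm by simp
      moreover have "f ((h \<bullet> x) \<bullet> y) = - 2 * f (D x \<bullet> y)"
        using arg_cong[OF D_half[OF x], of "\<lambda>t. f (t \<bullet> y)"] unfolding bilinear lin comm by simp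
      moreover have "f (h \<bullet> (x \<bullet> y)) = form h (x \<bullet> y) * f a - 2 * f (D (x \<bullet> y))"
        using arg_cong[OF D_half[OF xy], of f] unfolding lin by simp
      ultimately show "f (h \<bullet> (x \<bullet> y)) = f ((h \<bullet> x) \<bullet> y - (h \<bullet> y) \<bullet> x + form h (x \<bullet> y) *s a)"
        unfolding lin D by (simp add: algebra_simps)
    qed
  }
qed

lemma comp_zero_if:
  assumes "axial c" "c \<bullet> x = 0"
  shows "comp_zero scale mult form c x = x"
  by (simp add: comp_zero_eq assms form_eigenvector_zero axialD)

section \<open>Linear conditions on the half part\<close>

lemma axial_defect_scale: "axial_defect g (k *s h) x y = k *s axial_defect g h x y"
  unfolding axial_defect_def
  by (simp add: bilinear scale_right_distrib scale_right_diff_distrib mult.left_commute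
      mult.commute)

text \<open>Subtracting \<open>axial_mult_mult\<close> for \<open>g - h\<close> from the one for
  \<open>g + h\<close> cancels the part even in \<open>h\<close> and leaves twice the
  defect.\<close>

lemma axial_defect_eq_0:
  assumes "axial (g + h)" "axial (g - h)"
  shows "axial_defect g h x y = 0"
proof (rule eq_if_linear_functionals_eq, rule field_cancel_2)
  fix f assume "Vector_Spaces.linear scale (*) f"
  note lin = linear_functional_simps[OF this]
  have "2 * f (axial_defect g h x y) =
    (f ((g + h) \<bullet> (x \<bullet> y) + 4 *s (((g + h) \<bullet> x) \<bullet> ((g + h) \<bullet> y))) -
     f (x \<bullet> ((g + h) \<bullet> y) + y \<bullet> ((g + h) \<bullet> x) + form (g + h) y *s ((g + h) \<bullet> x) +
        form (g + h) x *s ((g + h) \<bullet> y) + form (g + h) (x \<bullet> y) *s (g + h))) -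
    (f ((g - h) \<bullet> (x \<bullet> y) + 4 *s (((g - h) \<bullet> x) \<bullet> ((g - h) \<bullet> y))) -
     f (x \<bullet> ((g - h) \<bullet> y) + y \<bullet> ((g - h) \<bullet> x) + form (g - h) y *s ((g - h) \<bullet> x) +
        form (g - h) x *s ((g - h) \<bullet> y) + form (g - h) (x \<bullet> y) *s (g - h)))"
    unfolding axial_defect_def bilinear lin by algebra
  then show "2 * f (axial_defect g h x y) = 2 * f 0"
    by (simp add: axial_mult_mult[OF assms(1)] axial_mult_mult[OF assms(2)] lin)
qed

text \<open>For fixed \<open>h\<close> the defect is affine in \<open>g\<close>, with constant term
  \<open>axial_defect 0 h x y\<close>. The combination eliminates \<open>z\<close>, and also the
  constant term when \<open>r - s * r' = 1 - s\<close>.\<close>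

lemma axial_defect_affine:
  "axial_defect (r *s a + s *s z) h x y - s *s axial_defect (r' *s a + z) h x y =
    (r - s * r') *s axial_defect a h x y + (1 - s - (r - s * r')) *s axial_defect 0 h x y"
proof (rule eq_if_linear_functionals_eq)
  fix f assume "Vector_Spaces.linear scale (*) f"
  note lin = linear_functional_simps[OF this]
  show "f (axial_defect (r *s a + s *s z) h x y - s *s axial_defect (r' *s a + z) h x y) =
    f ((r - s * r') *s axial_defect a h x y + (1 - s - (r - s * r')) *s axial_defect 0 h x y)"
    unfolding axial_defect_def bilinear lin by algebra
qed

text \<open>
  The half part \<open>h\<close> of \<open>b\<close> is a tangent direction at \<open>a\<close>: both \<open>b\<close> and \<open>\<tau>\<^sub>b(a)\<close> give a linear condition on
  \<open>h\<close>, and the right combination of the two is the condition at \<open>a\<close>.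
\<close>
lemma axial_defect_half_part:
  assumes a: "axial a" and b: "axial b"
    and ab: "4 * form a b \<noteq> 1" "2 * form a b \<noteq> 1"
  defines "h \<equiv> 2 *s (a \<bullet> b) - (2 * form a b) *s a"
  shows "axial_defect a h x y = 0"
proof -
  define \<beta> where "\<beta> = form a b"
  define z where "z = b + \<beta> *s a - 2 *s (a \<bullet> b)"
  define k where "k = 4 * \<beta> - 2"
  have h: "h = 2 *s (a \<bullet> b) - (2 * \<beta>) *s a" by (simp add: h_def \<beta>_def)
  have ba: "b \<bullet> a = a \<bullet> b" "form b a = \<beta>" by (simp_all add: mult_commute form_commute \<beta>_def)
  have "miyamoto a z = z"
    using axial_zero_part[OF a, of b] axialD(1)[OF a]
    by (auto simp: z_def \<beta>_def intro: miyamoto_eigenvector_zero)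
  moreover have "miyamoto a h = - h"
    unfolding h_def by (rule miyamoto_eigenvector_half[OF axialD(1)[OF a] axial_half_part[OF a]])
  \<comment> \<open>Reflecting an axis at \<open>a\<close> only changes the sign of its
    \<open>h\<close>-part, which provides the pairs required by
    \<open>axial_defect_eq_0\<close>.\<close>
  ultimately have refl: "miyamoto a (r *s a + s *s z + t *s h) = r *s a + s *s z - t *s h"
    for r s t by (simp add: miyamoto_simps miyamoto_self[OF a])
  have b_eq: "b = \<beta> *s a + 1 *s z + 1 *s h"
    by (simp add: z_def h scale_double)
  have c_eq: "miyamoto b a = ((1 - 2 * \<beta>) ^ 2) *s a + (4 * \<beta>) *s z + k *s h"
  proof (rule eq_if_linear_functionals_eq)
    fix f assume "Vector_Spaces.linear scale (*) f"
    note lin = linear_functional_simps[OF this]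
    show "f (miyamoto b a) = f (((1 - 2 * \<beta>) ^ 2) *s a + (4 * \<beta>) *s z + k *s h)"
      unfolding miyamoto_def z_def h k_def ba lin by algebra
  qed
  have 1: "axial_defect (\<beta> *s a + z) h x y = 0"
    using axial_defect_eq_0[of "\<beta> *s a + z" h x y] b axial_miyamoto(1)[OF a b]
      refl[of \<beta> 1 1] b_eq by simp
  note c = axial_miyamoto(1)[OF b a]
  have "axial_defect ((1 - 2 * \<beta>) ^ 2 *s a + (4 * \<beta>) *s z) (k *s h) x y = 0"
    using axial_defect_eq_0[of "(1 - 2 * \<beta>) ^ 2 *s a + (4 * \<beta>) *s z" "k *s h" x y]
      c axial_miyamoto(1)[OF a c] refl[of "(1 - 2 * \<beta>) ^ 2" "4 * \<beta>" k] c_eq by simp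
  moreover have "k \<noteq> 0"
  proof
    assume "k = 0"
    then have "2 * (2 * \<beta>) = 2 * (1 :: 'f)" by (simp add: k_def)
    then show False using field_cancel_2 ab(2) \<beta>_def by blast
  qed
  ultimately have 2: "axial_defect ((1 - 2 * \<beta>) ^ 2 *s a + (4 * \<beta>) *s z) h x y = 0"
    by (simp add: axial_defect_scale)
  \<comment> \<open>Here \<open>s\<close> is \<open>4 * \<beta>\<close>, so
    \<open>r - s * r'\<close> equals \<open>1 - s\<close>: the constant term drops out and only the
    defect at \<open>a\<close> remains.\<close>
  have "(1 - 2 * \<beta>) ^ 2 - 4 * \<beta> * \<beta> = 1 - 4 * \<beta>" by algebra
  then have "(1 - 4 * \<beta>) *s axial_defect a h x y = 0"
    using axial_defect_affine[of "(1 - 2 * \<beta>) ^ 2" a "4 * \<beta>" z h x y \<beta>] 1 2 by simp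
  then show ?thesis using ab(1) by (simp add: \<beta>_def)
qed

subsection \<open>Two axes at a right angle\<close>

lemma eq_neg_self_imp_0: "x = - x \<Longrightarrow> x = (0::'f)"
  using two_neq_0 by (metis add.right_inverse mult_2 mult_eq_0_iff)

text \<open>Multiplications by \<open>p\<close> and \<open>q\<close> commute, and \<open>z\<close>
  is orthogonal to both axes, so only their eigenvalues \<open>0\<close> and \<open>1/2\<close>
  occur. Two such eigenvalues with sum \<open>0\<close> are both \<open>0\<close>.\<close>

lemma orthogonal_axes_annihilated:
  assumes p: "axial p" and q: "axial q" and pq: "p \<bullet> q = 0" and z: "(p + q) \<bullet> z = 0"
  shows "p \<bullet> z = 0"
proof -
  have qp: "q \<bullet> p = 0" using pq by (metis mult_commute)
  have qz: "q \<bullet> z = - (p \<bullet> z)" using z by (simp add: bilinear add_eq_0_iff)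
  have "form p z = form p ((p + q) \<bullet> z)" "form q z = form q ((p + q) \<bullet> z)"
    by (simp_all add: form_assoc[symmetric] bilinear pq qp axialD[OF p] axialD[OF q])
  then have f: "form p z = 0" "form q z = 0" using z by (simp_all only: form_simps)
  have "q \<bullet> (q \<bullet> z) = - (q \<bullet> (p \<bullet> z))" by (simp add: qz bilinear)
  also have "q \<bullet> (p \<bullet> z) = p \<bullet> (q \<bullet> z)" using axial_mult_commute[OF p pq, of z] by simp
  finally have "2 *s (q \<bullet> (q \<bullet> z)) = 2 *s (p \<bullet> (p \<bullet> z))" by (simp add: qz bilinear)
  then have "- (p \<bullet> z) = p \<bullet> z" using axialD(3)[OF p, of z] axialD(3)[OF q, of z] f qz by simp
  then have "2 *s (p \<bullet> z) = 2 *s 0"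
    unfolding scale_2 by (metis add.right_inverse add_0)
  then show ?thesis by (simp only: cancel_2)
qed

text \<open>As before only the eigenvalues \<open>0\<close> and \<open>1/2\<close> occur, and two of
  them with sum \<open>1\<close> are both \<open>1/2\<close>.\<close>

lemma orthogonal_axes_half:
  assumes p: "axial p" and q: "axial q" and pq: "p \<bullet> q = 0"
    and v: "(p + q) \<bullet> v = v" "form p v = 0" "form q v = 0"
  shows "2 *s (p \<bullet> v) = v"
proof -
  have qv: "q \<bullet> v = v - p \<bullet> v" using v(1) by (simp add: bilinear eq_diff_eq add.commute)
  have "q \<bullet> (p \<bullet> v) = p \<bullet> (q \<bullet> v)" using axial_mult_commute[OF p pq, of v] by simp
  then have "2 *s (q \<bullet> (p \<bullet> v)) = 2 *s (p \<bullet> v) - p \<bullet> v"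
    using axialD(3)[OF p, of v] v(2) by (simp add: qv bilinear scale_right_diff_distrib)
  moreover have "2 *s (q \<bullet> (v - p \<bullet> v)) = v - p \<bullet> v"
    using axialD(3)[OF q, of v] v(3) by (simp add: qv)
  ultimately have "2 *s (q \<bullet> v) - (2 *s (p \<bullet> v) - p \<bullet> v) = v - p \<bullet> v"
    by (simp add: bilinear(3) scale_right_diff_distrib)
  then show ?thesis
    using scale_double[of 1 v] scale_double[of 1 "p \<bullet> v"]
    by (simp add: qv scale_right_diff_distrib algebra_simps)
qed

end

text \<open>
  For \<open>(a,b) = 1/2\<close> the reflections generate a group of order \<open>8\<close> on the line.  In terms of the spin
  factor with unit \<open>u\<close> and vectors \<open>e, e'\<close> with \<open>e\<^sup>2 = e'\<^sup>2 = u\<close>, \<open>ee' = 0\<close> one has \<open>a = (u + e)/2\<close>, \<open>c = (u - e)/2\<close>,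
  \<open>b = (u + e')/2\<close>, \<open>b' = (u - e')/2\<close>, and \<open>\<phi>\<close> is the half turn of the plane spanned by \<open>e\<close> and \<open>e'\<close>.
\<close>
locale right_angle = frobenius_algebra_odd scale mult form
  for scale :: "'f::field \<Rightarrow> 'a::ab_group_add \<Rightarrow> 'a" (infixr \<open>*s\<close> 75)
    and mult :: "'a \<Rightarrow> 'a \<Rightarrow> 'a"  (infixl \<open>\<bullet>\<close> 70)
    and form :: "'a \<Rightarrow> 'a \<Rightarrow> 'f" +
  fixes a b :: 'a
  assumes a: "axial a" and b: "axial b" and ab: "2 * form a b = 1"
begin

section \<open>The spin factor generated by the two axes\<close>

definition c where "c = miyamoto b a"
definition b' where "b' = miyamoto a b"
definition u where "u = 2 *s a + 2 *s b - 4 *s (a \<bullet> b)"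
definition e where "e = 2 *s a - u"
definition e' where "e' = 2 *s b - u"
definition \<phi> where "\<phi> x = miyamoto a (miyamoto b x)"
definition D where "D = comm_map (mult a) (mult b)"

lemma aa: "a \<bullet> a = a" "form a a = 1" and bb: "b \<bullet> b = b" "form b b = 1"
  using axialD[OF a] axialD[OF b] by simp_all

lemma four_form: "4 * form a b = 2"
  using arg_cong[OF ab, of "\<lambda>t. 2 * t"] by simp

lemma ba: "b \<bullet> a = a \<bullet> b" "form b a = form a b"
  by (rule mult_commute form_commute)+

lemma c_eq: "c = u - a"
  unfolding c_def u_def miyamoto_def ba four_form using scale_double[of 1 a] by simp

lemma b'_eq: "b' = u - b"
  unfolding b'_def u_def miyamoto_def four_form using scale_double[of 1 b] by simp

lemma axial_c: "axial c" and axial_b': "axial b'"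
  unfolding c_def b'_def using a b by (auto intro: axial_miyamoto)

lemma four_mult_mult: "4 *s (a \<bullet> (a \<bullet> b)) = 2 *s (a \<bullet> b) + a" "4 *s (b \<bullet> (a \<bullet> b)) = 2 *s (a \<bullet> b) + b"
proof -
  have "4 *s x = 2 *s (2 *s x)" for x by simp
  then show "4 *s (a \<bullet> (a \<bullet> b)) = 2 *s (a \<bullet> b) + a" "4 *s (b \<bullet> (a \<bullet> b)) = 2 *s (a \<bullet> b) + b"
    by (simp_all only: axialD(3)[OF a] axialD(3)[OF b, of a, unfolded ba] scale_right_distrib scale_scale[of 2 "form a b"]
        ab scale_one)
qed

lemma u_mult: "u \<bullet> a = a" "u \<bullet> b = b" "a \<bullet> u = a" "b \<bullet> u = b"
proof -
  show "a \<bullet> u = a" "b \<bullet> u = b"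
    unfolding u_def bilinear aa bb ba four_mult_mult
    using scale_double[of 1 a] scale_double[of 1 b] by simp_all
  then show "u \<bullet> a = a" "u \<bullet> b = b" by (metis mult_commute)+
qed

lemma ac: "a \<bullet> c = 0" and bb': "b \<bullet> b' = 0"
  by (simp_all add: c_eq b'_eq bilinear u_mult aa bb)

text \<open>It remains to see that \<open>u\<close> fixes \<open>a \<bullet> b\<close>. Since
  \<open>a \<bullet> c = 0\<close>, multiplications by \<open>a\<close> and \<open>c\<close>
  commute, and applying this to \<open>b\<close> with \<open>c = u - a\<close> gives the
  claim.\<close>

lemma u_u: "u \<bullet> u = u"
proof -
  have "u \<bullet> (a \<bullet> b) = a \<bullet> b"
    using axial_mult_commute[OF a ac, of b] by (simp add: c_eq bilinear u_mult)
  then show ?thesis by (subst (2) u_def) (simp add: bilinear u_mult, simp add: u_def)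
qed

lemma form_u: "form u x = form a x + form c x" "form u x = form b x + form b' x"
  by (simp_all add: c_eq b'_eq bilinear)

lemma form_line:
  "form a u = 1" "form b u = 1" "form u a = 1" "form u b = 1" "form u u = 2"
proof -
  show 1: "form a u = 1" "form b u = 1"
    by (metis form_assoc u_mult(3,4) aa bb form_commute)+
  then show 2: "form u a = 1" "form u b = 1" by (simp_all only: form_commute)
  have "form u (a \<bullet> b) = form a b" by (simp add: form_assoc[symmetric] u_mult)
  then have "form u (2 *s a + 2 *s b - 4 *s (a \<bullet> b)) = 2"
    unfolding bilinear by (simp add: 2 four_form)
  then show "form u u = 2" by (simp only: u_def[symmetric])
qed

lemma form_e: "form a e = 1" "form b e = 0" "form u e = 0" "form a e' = 0" "form b e' = 1" "form u e' = 0"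
  by (simp_all add: e_def e'_def bilinear form_line aa bb ba ab)

lemma e_mult: "e \<bullet> e = u" "e' \<bullet> e' = u" "e \<bullet> e' = 0" "e' \<bullet> e = 0"
proof -
  show "e \<bullet> e = u" "e' \<bullet> e' = u"
    unfolding e_def e'_def bilinear u_mult u_u aa bb
    using scale_double[of 2 a] scale_double[of 2 b] by (simp_all add: scale_right_diff_distrib)
  show "e \<bullet> e' = 0"
    unfolding e_def e'_def bilinear u_mult u_u by (simp add: scale_right_diff_distrib) (simp add: u_def)
  then show "e' \<bullet> e = 0" by (metis mult_commute)
qed

lemma \<phi>_simps: "\<phi> (x + y) = \<phi> x + \<phi> y" "\<phi> (x - y) = \<phi> x - \<phi> y" "\<phi> (- x) = - \<phi> x"
    "\<phi> (k *s x) = k *s \<phi> x" "\<phi> 0 = 0"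
  by (simp_all add: \<phi>_def miyamoto_simps)

lemma \<phi>_mult: "\<phi> (x \<bullet> y) = \<phi> x \<bullet> \<phi> y"
  by (simp add: \<phi>_def axialD(4)[OF a] axialD(4)[OF b])

lemma form_\<phi>: "form (\<phi> x) (\<phi> y) = form x y"
  by (simp add: \<phi>_def form_miyamoto[OF a] form_miyamoto[OF b])

text \<open>\<phi> sends \<open>a\<close> first to \<open>c\<close>, which \<open>miyamoto a\<close>
  fixes because \<open>a \<bullet> c = 0\<close>, and it sends \<open>b\<close> to
  \<open>b'\<close>. Products then give the value on \<open>u\<close>.\<close>

lemma \<phi>_line: "\<phi> a = u - a" "\<phi> b = u - b" "\<phi> u = u" "\<phi> e = - e" "\<phi> e' = - e'"
proof -
  show 1: "\<phi> a = u - a"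
    using miyamoto_eigenvector_zero[OF aa(1) ac] unfolding \<phi>_def c_def[symmetric] by (simp add: c_eq)
  show 2: "\<phi> b = u - b"
    unfolding \<phi>_def miyamoto_self[OF b] b'_def[symmetric] by (rule b'_eq)
  have "\<phi> (a \<bullet> b) = (u - a) \<bullet> (u - b)" by (simp add: \<phi>_mult 1 2)
  also have "\<dots> = u - a - b + a \<bullet> b" by (simp add: bilinear u_u u_mult)
  finally have "\<phi> u = 2 *s (u - a) + 2 *s (u - b) - 4 *s (u - a - b + a \<bullet> b)"
    by (simp only: u_def[THEN arg_cong, of \<phi>] \<phi>_simps 1 2)
  also have "\<dots> = u"
  proof (rule eq_if_linear_functionals_eq)
    fix f assume "Vector_Spaces.linear scale (*) f"
    note lin = linear_functional_simps[OF this]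
    show "f (2 *s (u - a) + 2 *s (u - b) - 4 *s (u - a - b + a \<bullet> b)) = f u"
      unfolding lin u_def by algebra
  qed
  finally show 3: "\<phi> u = u" .
  have "2 *s x = x + x" for x using scale_double[of 1 x] by simp
  then show "\<phi> e = - e" "\<phi> e' = - e'" by (simp_all add: e_def e'_def \<phi>_simps 1 2 3)
qed

lemma D_simps: "D (x + y) = D x + D y" "D (x - y) = D x - D y" "D (- x) = - D x"
    "D (k *s x) = k *s D x" "D 0 = 0"
  by (simp_all add: D_def comm_map_def bilinear scale_right_diff_distrib)

lemma D_line: "D u = 0" "4 *s D e = - e'" "4 *s D e' = e"
proof -
  show Du: "D u = 0" by (simp add: D_def comm_map_def u_mult ba)
  have "4 *s D a = 4 *s (a \<bullet> (a \<bullet> b)) - 4 *s (a \<bullet> b)"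
    by (simp add: D_def comm_map_def aa ba scale_right_diff_distrib)
  then have a': "4 *s D a = a - 2 *s (a \<bullet> b)"
    unfolding four_mult_mult using scale_double[of 2 "a \<bullet> b"] by simp
  have "4 *s D b = 4 *s (a \<bullet> b) - 4 *s (b \<bullet> (a \<bullet> b))"
    by (simp add: D_def comm_map_def bb ba scale_right_diff_distrib)
  then have b': "4 *s D b = 2 *s (a \<bullet> b) - b"
    unfolding four_mult_mult using scale_double[of 2 "a \<bullet> b"] by simp
  have "4 *s D e = 2 *s (4 *s D a)" "4 *s D e' = 2 *s (4 *s D b)"
    by (simp_all add: e_def e'_def D_simps Du)
  then show "4 *s D e = - e'" "4 *s D e' = e"
    unfolding a' b' e_def e'_def u_def
    by (simp_all add: scale_right_diff_distrib)
qed

section \<open>The order of \<phi> and the commutator on its eigenspaces\<close>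

lemma miyamoto_c: "miyamoto c x = miyamoto b (miyamoto a (miyamoto b x))"
  unfolding c_def by (rule axial_miyamoto(2)[OF b a])

lemma \<phi>_\<phi>: "\<phi> (\<phi> x) = miyamoto a (miyamoto c x)"
  by (simp add: \<phi>_def miyamoto_c)

text \<open>Orthogonality of \<open>a\<close> and \<open>c\<close> makes their multiplications
  commute. Hence the square of \<phi> is a product of two commuting involutions.\<close>

lemma miyamoto_a_c: "miyamoto a (miyamoto c x) = miyamoto c (miyamoto a x)"
proof (rule eq_if_linear_functionals_eq)
  fix f assume "Vector_Spaces.linear scale (*) f"
  note lin = linear_functional_simps[OF this]
  have ca: "c \<bullet> a = 0" using ac by (metis mult_commute)
  have 1: "form a (c \<bullet> x) = 0" "form c (a \<bullet> x) = 0"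
    by (simp_all add: form_assoc[symmetric] ac ca bilinear)
  have 2: "form a c = 0" "form c a = 0"
    using form_eigenvector_zero[OF aa(1) ac] form_commute by simp_all
  show "f (miyamoto a (miyamoto c x)) = f (miyamoto c (miyamoto a x))"
    unfolding miyamoto_def bilinear lin ac ca 1 2 axial_mult_commute[OF a ac, of x] by algebra
qed

lemma \<phi>_four: "\<phi> (\<phi> (\<phi> (\<phi> x))) = x"
  by (simp add: \<phi>_\<phi> miyamoto_a_c miyamoto_miyamoto[OF a] miyamoto_miyamoto[OF axial_c])

text \<open>The involutions of \<open>a\<close> and \<open>c\<close> agree on \<open>v\<close>, so
  its half parts at \<open>a\<close> and \<open>c\<close> agree too. This makes multiplication by
  \<open>u\<close> idempotent on \<open>v\<close>: the part \<open>z\<close> killed by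
  \<open>u\<close> is killed by \<open>a\<close> and \<open>b\<close>, and what \<open>u\<close>
  fixes and is orthogonal to the spin factor has eigenvalue \<open>1/2\<close> for both
  axes.\<close>

lemma \<phi>_\<phi>_fixed_decomposition:
  assumes v: "\<phi> (\<phi> v) = v"
  obtains z y \<alpha> \<beta> \<gamma> where
    "v = z + \<alpha> *s u + \<beta> *s e + \<gamma> *s e' + y" "2 * \<beta> = form e v" "2 * \<gamma> = form e' v"
    "a \<bullet> z = 0" "b \<bullet> z = 0" "2 *s (a \<bullet> y) = y" "2 *s (b \<bullet> y) = y"
proof -
  obtain t :: 'f where t: "2 * t = 1" using exists_half by blast
  have "miyamoto c v = miyamoto a (\<phi> (\<phi> v))" by (simp add: \<phi>_\<phi> miyamoto_miyamoto[OF a])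
  then have cv: "miyamoto c v = miyamoto a v" by (simp add: v)
  have uc: "u = a + c" "u = b + b'" by (simp_all add: c_eq b'_eq)
  \<comment> \<open>This is one half of the half part of \<open>v\<close> at
    \<open>a\<close>.\<close>
  define q where "q = a \<bullet> v - form a v *s a"
  have "4 *s (c \<bullet> v - form c v *s c) = 4 *s q"
    using cv unfolding miyamoto_def q_def
    by (simp add: scale_right_diff_distrib algebra_simps)
  then have q': "q = c \<bullet> v - form c v *s c" using four_neq_0 by (metis scale_left_imp_eq)
  have half: "2 *s (p \<bullet> (p \<bullet> v - form p v *s p)) = p \<bullet> v - form p v *s p" if "axial p" for p
    using axialD(3)[OF that, of v] scale_double[of "form p v" p]
    by (simp add: bilinear axialD(1)[OF that] scale_right_diff_distrib)
  have "2 *s (a \<bullet> q) = q" "2 *s (c \<bullet> q) = q"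
    using half[OF a] half[OF axial_c] by (simp_all add: q_def[symmetric] q'[symmetric])
  then have "2 *s (u \<bullet> q) = 2 *s q"
    unfolding uc(1) using scale_double[of 1 q] by (simp add: bilinear scale_right_distrib)
  then have uq: "u \<bullet> q = q" by (simp only: cancel_2)
  have uv: "u \<bullet> v = 2 *s q + form a v *s a + form c v *s c"
  proof -
    have "a \<bullet> v = q + form a v *s a" "c \<bullet> v = q + form c v *s c"
      by (simp add: q_def) (simp add: q')
    then show ?thesis using scale_double[of 1 q] by (simp add: uc(1) bilinear)
  qed
  have ucc: "u \<bullet> c = c" by (simp add: c_eq bilinear u_u u_mult)
  have uuv: "u \<bullet> (u \<bullet> v) = u \<bullet> v" unfolding uv bilinear uq u_mult ucc ..
  define z where "z = v - u \<bullet> v"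
  have uz: "u \<bullet> z = 0" by (simp add: z_def bilinear uuv)
  \<comment> \<open>\<open>u\<close>, \<open>e\<close>, \<open>e'\<close> are pairwise orthogonal
    and each pairs with itself to \<open>2\<close>, so \<open>t\<close>, which is one half, gives
    the orthogonal projection.\<close>
  define y where "y = u \<bullet> v - (t * form u v) *s u - (t * form e v) *s e - (t * form e' v) *s e'"
  have ue: "u \<bullet> e = e" "u \<bullet> e' = e'" by (simp_all add: e_def e'_def bilinear u_u u_mult)
  have uy: "u \<bullet> y = y" unfolding y_def bilinear uuv ue u_u ..
  have uf: "form u (u \<bullet> v) = form u v" "form a (u \<bullet> v) = form a v" "form b (u \<bullet> v) = form b v"
    by (simp_all add: form_assoc[symmetric] u_u u_mult)
  have "form u y = form u v - t * form u v * 2"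
    unfolding y_def bilinear uf form_e form_line by simp
  then have fuy: "form u y = 0" using t by algebra
  have "form a y = form a v - t * form u v - t * (2 * form a v - form u v)"
    unfolding y_def bilinear uf form_e form_line by (simp add: e_def bilinear)
  then have fay: "form a y = 0" using t by algebra
  have "form b y = form b v - t * form u v - t * (2 * form b v - form u v)"
    unfolding y_def bilinear uf form_e form_line by (simp add: e'_def bilinear)
  then have fby: "form b y = 0" using t by algebra
  show thesis
  proof (rule that)
    show "v = z + (t * form u v) *s u + (t * form e v) *s e + (t * form e' v) *s e' + y"
      by (simp add: z_def y_def)
    show "2 * (t * form e v) = form e v" "2 * (t * form e' v) = form e' v"
      using t by algebra+
    show "a \<bullet> z = 0" using orthogonal_axes_annihilated[OF a axial_c ac] uz uc(1) by simp
    show "b \<bullet> z = 0" using orthogonal_axes_annihilated[OF b axial_b' bb'] uz uc(2) by simp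
    show "2 *s (a \<bullet> y) = y"
      using orthogonal_axes_half[OF a axial_c ac, of y] uy uc(1) fay fuy form_u(1)[of y] by simp
    show "2 *s (b \<bullet> y) = y"
      using orthogonal_axes_half[OF b axial_b' bb', of y] uy uc(2) fby fuy form_u(2)[of y] by simp
  qed
qed

text \<open>\<open>z\<close> and \<open>u\<close> are killed, and so is \<open>y\<close>, on which
  both axes act as \<open>1/2\<close>; only the plane of \<open>e\<close> and \<open>e'\<close>
  contributes.\<close>

lemma D_if_\<phi>_\<phi>_fixed:
  assumes "\<phi> (\<phi> v) = v"
  shows "8 *s D v = form e' v *s e - form e v *s e'"
proof -
  obtain z y \<alpha> \<beta> \<gamma> where v:
    "v = z + \<alpha> *s u + \<beta> *s e + \<gamma> *s e' + y" "2 * \<beta> = form e v" "2 * \<gamma> = form e' v"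
    "a \<bullet> z = 0" "b \<bullet> z = 0" "2 *s (a \<bullet> y) = y" "2 *s (b \<bullet> y) = y"
    using \<phi>_\<phi>_fixed_decomposition[OF assms] .
  have "D z = 0" by (simp add: D_def comm_map_def v(4,5) bilinear)
  moreover have "2 *s (2 *s D y) = 2 *s 0"
  proof -
    have "2 *s (a \<bullet> (2 *s (b \<bullet> y))) = y" "2 *s (b \<bullet> (2 *s (a \<bullet> y))) = y"
      unfolding v(6,7) by simp_all
    then show ?thesis by (simp add: D_def comm_map_def bilinear scale_right_diff_distrib)
  qed
  then have "D y = 0" using four_neq_0 by simp
  ultimately have "8 *s D v = (2 * \<beta>) *s (4 *s D e) + (2 * \<gamma>) *s (4 *s D e')"
    by (subst v(1)) (simp add: D_simps D_line(1) scale_right_distrib)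
  then show ?thesis unfolding D_line v(2,3) by simp
qed

text \<open>\<phi> fixes \<open>z\<close>, \<open>u\<close> and \<open>y\<close> in the
  decomposition of \<open>v\<close>, so a negated vector lies in the plane of \<open>e\<close> and
  \<open>e'\<close>.\<close>

lemma \<phi>_negated:
  assumes "\<phi> v = - v"
  shows "2 *s v = form e v *s e + form e' v *s e'"
proof -
  have fixed: "\<phi> (\<phi> v) = v" by (simp add: assms \<phi>_simps)
  obtain z y \<alpha> \<beta> \<gamma> where v:
    "v = z + \<alpha> *s u + \<beta> *s e + \<gamma> *s e' + y" "2 * \<beta> = form e v" "2 * \<gamma> = form e' v"
    "a \<bullet> z = 0" "b \<bullet> z = 0" "2 *s (a \<bullet> y) = y" "2 *s (b \<bullet> y) = y"
    using \<phi>_\<phi>_fixed_decomposition[OF fixed] .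
  have "\<phi> z = z" "\<phi> y = y"
    by (simp_all add: \<phi>_def miyamoto_simps miyamoto_eigenvector_zero aa bb v(4,5)
        miyamoto_eigenvector_half[OF aa(1) v(6)] miyamoto_eigenvector_half[OF bb(1) v(7)])
  then have \<phi>v: "\<phi> v = z + \<alpha> *s u - \<beta> *s e - \<gamma> *s e' + y"
    by (subst v(1)) (simp add: \<phi>_simps \<phi>_line)
  show ?thesis
  proof (rule eq_if_linear_functionals_eq)
    fix f assume "Vector_Spaces.linear scale (*) f"
    note lin = linear_functional_simps[OF this]
    have "f (- v) = f (z + \<alpha> *s u - \<beta> *s e - \<gamma> *s e' + y)" using \<phi>v assms by simp
    moreover have "f v = f (z + \<alpha> *s u + \<beta> *s e + \<gamma> *s e' + y)" using v(1) by simp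
    ultimately show "f (2 *s v) = f (form e v *s e + form e' v *s e')"
      unfolding lin v(2,3)[symmetric] by algebra
  qed
qed

text \<open>The isometry \<phi> negates \<open>e\<close> and \<open>e'\<close>, so a fixed vector is
  orthogonal to both.\<close>

lemma D_if_\<phi>_fixed:
  assumes "\<phi> v = v"
  shows "D v = 0"
proof -
  have "form e v = - form e v" "form e' v = - form e' v"
    using form_\<phi>[of e v] form_\<phi>[of e' v] by (simp_all add: assms \<phi>_line bilinear)
  then have "form e v = 0" "form e' v = 0" by (blast intro: eq_neg_self_imp_0)+
  then have "8 *s D v = 0" using D_if_\<phi>_\<phi>_fixed[of v] assms by simp
  moreover have "(8::'f) = 2 * 4" by simp
  ultimately show ?thesis using two_neq_0 four_neq_0 by (metis mult_eq_0_iff scale_eq_0_iff)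
qed

lemma form_eq_0_if_\<phi>_\<phi>:
  assumes p: "\<phi> (\<phi> p) = p" and w: "\<phi> (\<phi> w) = - w"
  shows "form p w = 0"
proof (rule eq_neg_self_imp_0)
  have "form p w = form (\<phi> (\<phi> p)) (\<phi> (\<phi> w))" by (simp only: form_\<phi>)
  then show "form p w = - form p w" by (simp only: p w bilinear)
qed

text \<open>\<open>w\<close> is orthogonal to the spin factor, and the involutions of
  \<open>a\<close> and \<open>c\<close> differ on it by a sign. This forces \<open>u\<close> to act
  on \<open>w\<close> as \<open>1/2\<close>, which cancels the identity part of each
  involution.\<close>

lemma \<phi>_\<phi>_negated:
  assumes w: "\<phi> (\<phi> w) = - w"
  shows "miyamoto a w = - 2 *s (e \<bullet> w)" "miyamoto b w = - 2 *s (e' \<bullet> w)"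
proof -
  have "form p w = 0" if "\<phi> (\<phi> p) = p" for p
    by (rule form_eq_0_if_\<phi>_\<phi>[OF that w])
  then have f: "form a w = 0" "form b w = 0" "form u w = 0" by (simp_all add: \<phi>_simps \<phi>_line)
  then have fc: "form c w = 0" by (simp add: c_eq bilinear)
  have "miyamoto c w = - miyamoto a w"
    using w miyamoto_miyamoto[OF a] by (metis \<phi>_\<phi> miyamoto_simps(3))
  then have "2 *s (2 *s (u \<bullet> w)) = 2 *s w"
    using scale_double[of 1 w] unfolding miyamoto_def f fc
    by (simp add: c_eq bilinear algebra_simps)
  then have "2 *s (u \<bullet> w) = w" by (simp only: cancel_2)
  moreover have "miyamoto a w = w - 4 *s (a \<bullet> w)" "miyamoto b w = w - 4 *s (b \<bullet> w)"
    by (simp_all add: miyamoto_def f)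
  ultimately show "miyamoto a w = - 2 *s (e \<bullet> w)" "miyamoto b w = - 2 *s (e' \<bullet> w)"
    by (simp_all add: e_def e'_def bilinear scale_right_diff_distrib)
qed

lemma \<phi>_\<phi>_negated_miyamoto:
  assumes w: "\<phi> (\<phi> w) = - w"
  shows "\<phi> (\<phi> (miyamoto a w)) = - miyamoto a w" "\<phi> (\<phi> (miyamoto b w)) = - miyamoto b w"
proof -
  have *: "\<phi> (\<phi> (miyamoto a x)) = miyamoto a (\<phi> (\<phi> x))" for x
    by (simp add: \<phi>_\<phi> miyamoto_a_c)
  show "\<phi> (\<phi> (miyamoto a w)) = - miyamoto a w" by (simp add: * w miyamoto_simps)
  have "miyamoto b w = miyamoto a (\<phi> w)" by (simp add: \<phi>_def miyamoto_miyamoto[OF a])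
  then show "\<phi> (\<phi> (miyamoto b w)) = - miyamoto b w"
    by (simp add: * w \<phi>_simps miyamoto_simps)
qed

text \<open>The first equation is \<open>miyamoto a (\<phi> w) = miyamoto b w\<close> rewritten by
  the previous formulas; applying \<phi> to it gives the second.\<close>

lemma e_mult_\<phi>:
  assumes w: "\<phi> (\<phi> w) = - w"
  shows "e \<bullet> \<phi> w = e' \<bullet> w" "e' \<bullet> \<phi> w = - (e \<bullet> w)"
proof -
  have w': "\<phi> (\<phi> (\<phi> w)) = - \<phi> w" by (simp add: w \<phi>_simps)
  have "miyamoto a (\<phi> w) = miyamoto b w" by (simp add: \<phi>_def miyamoto_miyamoto[OF a])
  then have "2 *s (e \<bullet> \<phi> w) = 2 *s (e' \<bullet> w)"
    unfolding \<phi>_\<phi>_negated(1)[OF w'] \<phi>_\<phi>_negated(2)[OF w] by simp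
  then show 1: "e \<bullet> \<phi> w = e' \<bullet> w" by (simp only: cancel_2)
  have "\<phi> (e \<bullet> \<phi> w) = \<phi> (e' \<bullet> w)" by (simp only: 1)
  then show "e' \<bullet> \<phi> w = - (e \<bullet> w)" by (simp add: \<phi>_mult \<phi>_line w bilinear)
qed

text \<open>Here four times the multiplication by \<open>a\<close> or \<open>b\<close> is the
  identity minus its involution. So \<open>16 *s D w\<close> is the commutator of the involutions,
  \<phi> minus its inverse, and the inverse is the negative of \<phi>.\<close>

lemma D_if_\<phi>_\<phi>_negated:
  assumes w: "\<phi> (\<phi> w) = - w"
  shows "8 *s D w = \<phi> w"
proof -
  have four: "4 *s (p \<bullet> x) = x - miyamoto p x" if "form p x = 0" for p x
    using that by (simp add: miyamoto_def)
  have f: "form p x = 0" if "\<phi> (\<phi> x) = - x" "\<phi> (\<phi> p) = p" for p x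
    by (rule form_eq_0_if_\<phi>_\<phi>[OF that(2,1)])
  have fab: "\<phi> (\<phi> a) = a" "\<phi> (\<phi> b) = b" by (simp_all add: \<phi>_simps \<phi>_line)
  note wa = \<phi>_\<phi>_negated_miyamoto(1)[OF w] and wb = \<phi>_\<phi>_negated_miyamoto(2)[OF w]
  have "16 *s (a \<bullet> (b \<bullet> w)) = 4 *s (a \<bullet> (4 *s (b \<bullet> w)))" by (simp add: bilinear)
  also have "\<dots> = w - miyamoto b w - (miyamoto a w - \<phi> w)"
    unfolding four[OF f[OF w fab(2)]] using f[OF w fab(1)] f[OF wb fab(1)]
    by (subst four) (simp_all add: bilinear miyamoto_simps \<phi>_def)
  finally have 1: "16 *s (a \<bullet> (b \<bullet> w)) = w - miyamoto b w - (miyamoto a w - \<phi> w)" .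
  have "miyamoto b (miyamoto a w) = - miyamoto b (miyamoto a (\<phi> (\<phi> w)))"
    by (simp add: w miyamoto_simps)
  also have "\<dots> = - \<phi> w" by (simp add: \<phi>_def miyamoto_miyamoto[OF a] miyamoto_miyamoto[OF b])
  finally have wba: "miyamoto b (miyamoto a w) = - \<phi> w" .
  have "16 *s (b \<bullet> (a \<bullet> w)) = 4 *s (b \<bullet> (4 *s (a \<bullet> w)))" by (simp add: bilinear)
  also have "\<dots> = w - miyamoto a w - (miyamoto b w + \<phi> w)"
    unfolding four[OF f[OF w fab(1)]] using f[OF w fab(2)] f[OF wa fab(2)]
    by (subst four) (simp_all add: bilinear miyamoto_simps wba)
  finally have "16 *s D w = 2 *s \<phi> w"
    using 1 scale_double[of 1 "\<phi> w"]
    by (simp add: D_def comm_map_def scale_right_diff_distrib)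
  then have "2 *s (8 *s D w) = 2 *s \<phi> w" by simp
  then show ?thesis by (simp only: cancel_2)
qed

section \<open>The Leibniz rule on pairs of eigenspaces\<close>

definition leibniz where "leibniz x y \<longleftrightarrow> D (x \<bullet> y) = x \<bullet> D y + D x \<bullet> y"

lemma leibniz_commute: "leibniz x y \<Longrightarrow> leibniz y x"
  unfolding leibniz_def by (metis add.commute mult_commute)

lemma leibniz_add: "leibniz x y \<Longrightarrow> leibniz x' y \<Longrightarrow> leibniz (x + x') y"
  unfolding leibniz_def by (simp add: bilinear D_simps)

lemma leibniz_scale: "leibniz x y \<Longrightarrow> leibniz (k *s x) y"
  unfolding leibniz_def by (simp add: bilinear D_simps scale_right_distrib)

lemma leibniz_cancel:
  assumes "k \<noteq> 0" "leibniz (k *s x) y"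
  shows "leibniz x y"
  using leibniz_scale[OF assms(2), of "inverse k"] assms(1) by simp

lemma eight_neq_0: "(8::'f) \<noteq> 0"
proof -
  have "(8::'f) = 2 * 4" by simp
  then show ?thesis using two_neq_0 four_neq_0 by (metis mult_eq_0_iff)
qed

lemma leibniz_negated:
  assumes "\<phi> x = - x" "leibniz e y" "leibniz e' y"
  shows "leibniz x y"
  by (rule leibniz_cancel[OF two_neq_0])
    (simp only: \<phi>_negated[OF assms(1)] leibniz_add leibniz_scale assms)

text \<open>The order of \<phi> divides \<open>4\<close>, so sums and differences of
  \<open>x\<close> and its images split \<open>4 *s x\<close> into the three eigenspace pieces. The
  piece negated by \<phi> lies in the plane of \<open>e\<close> and \<open>e'\<close>.\<close>

lemma leibniz_decomposition:
  assumes "\<And>v. \<phi> v = v \<Longrightarrow> leibniz v y" "\<And>v. \<phi> (\<phi> v) = - v \<Longrightarrow> leibniz v y"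
    "leibniz e y" "leibniz e' y"
  shows "leibniz x y"
proof (rule leibniz_cancel[OF four_neq_0])
  define v where "v = x + \<phi> (\<phi> x)"
  define w where "w = x - \<phi> (\<phi> x)"
  have "leibniz (2 *s w) y"
    by (rule leibniz_scale, rule assms(2)) (simp add: w_def \<phi>_simps \<phi>_four)
  moreover have "leibniz (v + \<phi> v) y"
    by (rule assms(1)) (simp add: v_def \<phi>_simps \<phi>_four add_ac)
  moreover have "leibniz (v - \<phi> v) y"
    by (rule leibniz_negated[OF _ assms(3,4)]) (simp add: v_def \<phi>_simps \<phi>_four)
  moreover have "4 *s x = 2 *s w + ((v + \<phi> v) + (v - \<phi> v))"
    using scale_double[of 2 x] scale_double[of 1 x] scale_double[of 1 "\<phi> (\<phi> x)"]
    by (simp add: w_def v_def scale_right_diff_distrib)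
  ultimately show "leibniz (4 *s x) y" by (simp only: leibniz_add)
qed

lemma leibniz_fixed_fixed: "\<phi> x = x \<Longrightarrow> \<phi> y = y \<Longrightarrow> leibniz x y"
  by (simp add: leibniz_def D_if_\<phi>_fixed \<phi>_mult bilinear)

text \<open>\<phi> negates \<open>e \<bullet> x\<close> and \<open>e' \<bullet> x\<close>, so both
  lie in the plane. Pairing with \<open>e\<close> and \<open>e'\<close> shows that \<open>x\<close>
  acts there as the scalar \<open>1/2 * form u x\<close>, and \<open>D x = 0\<close>.\<close>

lemma leibniz_line_fixed:
  assumes x: "\<phi> x = x"
  shows "leibniz e x" "leibniz e' x"
proof -
  have "\<phi> (e \<bullet> x) = - (e \<bullet> x)" "\<phi> (e' \<bullet> x) = - (e' \<bullet> x)"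
    by (simp_all add: \<phi>_mult x \<phi>_line bilinear)
  note n = \<phi>_negated[OF this(1)] \<phi>_negated[OF this(2)]
  have 1: "2 *s (e \<bullet> x) = form u x *s e" "2 *s (e' \<bullet> x) = form u x *s e'"
    using n by (simp_all add: form_assoc[symmetric] e_mult bilinear)
  have "8 *s D (e \<bullet> x) = 4 *s D (2 *s (e \<bullet> x))" by (simp add: D_simps)
  also have "\<dots> = form u x *s (4 *s D e)" unfolding 1 by (simp add: D_simps mult.commute)
  also have "\<dots> = - (2 *s (e' \<bullet> x))" unfolding D_line 1 by simp
  also have "\<dots> = 2 *s ((4 *s D e) \<bullet> x)" unfolding D_line by (simp add: bilinear)
  also have "\<dots> = 8 *s (D e \<bullet> x)" by (simp add: bilinear)
  finally show "leibniz e x"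
    using eight_neq_0 scale_left_imp_eq by (auto simp: leibniz_def D_if_\<phi>_fixed[OF x] bilinear)
  have "8 *s D (e' \<bullet> x) = 4 *s D (2 *s (e' \<bullet> x))" by (simp add: D_simps)
  also have "\<dots> = form u x *s (4 *s D e')" unfolding 1 by (simp add: D_simps mult.commute)
  also have "\<dots> = 2 *s (e \<bullet> x)" unfolding D_line 1 by simp
  also have "\<dots> = 2 *s ((4 *s D e') \<bullet> x)" unfolding D_line by (simp add: bilinear)
  also have "\<dots> = 8 *s (D e' \<bullet> x)" by (simp add: bilinear)
  finally show "leibniz e' x"
    using eight_neq_0 scale_left_imp_eq by (auto simp: leibniz_def D_if_\<phi>_fixed[OF x] bilinear)
qed

lemma leibniz_if_8:
  "8 *s D (x \<bullet> y) = x \<bullet> (8 *s D y) + (8 *s D x) \<bullet> y \<Longrightarrow> leibniz x y"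
  using eight_neq_0 scale_left_imp_eq[of 8 "D (x \<bullet> y)" "x \<bullet> D y + D x \<bullet> y"]
  by (simp add: leibniz_def bilinear scale_right_distrib)

lemma D_line_8: "8 *s D e = - 2 *s e'" "8 *s D e' = 2 *s e"
  using arg_cong[OF D_line(2), of "\<lambda>t. 2 *s t"] arg_cong[OF D_line(3), of "\<lambda>t. 2 *s t"] by simp_all

lemma leibniz_line_line: "leibniz e e" "leibniz e e'" "leibniz e' e'"
  by (rule leibniz_if_8, simp add: D_line_8 D_line(1) bilinear e_mult D_simps)+

lemma leibniz_fixed_negated:
  assumes x: "\<phi> x = x" and w: "\<phi> (\<phi> w) = - w"
  shows "leibniz x w"
proof (rule leibniz_if_8)
  have "\<phi> (\<phi> (x \<bullet> w)) = - (x \<bullet> w)" by (simp add: \<phi>_mult x w bilinear)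
  then show "8 *s D (x \<bullet> w) = x \<bullet> (8 *s D w) + (8 *s D x) \<bullet> w"
    by (simp add: D_if_\<phi>_\<phi>_negated w \<phi>_mult x D_if_\<phi>_fixed bilinear)
qed

text \<open>Both products stay in the space where \<open>8 *s D\<close> is \<phi>. With
  \<open>e_mult_\<phi>\<close> the two sides of the rule become \<open>- (e' \<bullet> w)\<close>
  for \<open>e\<close> and \<open>e \<bullet> w\<close> for \<open>e'\<close>.\<close>

lemma leibniz_line_negated:
  assumes w: "\<phi> (\<phi> w) = - w"
  shows "leibniz e w" "leibniz e' w"
proof -
  have "\<phi> (\<phi> (e \<bullet> w)) = - (e \<bullet> w)" "\<phi> (\<phi> (e' \<bullet> w)) = - (e' \<bullet> w)"
    by (simp_all add: \<phi>_mult \<phi>_line w bilinear \<phi>_simps)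
  then show "leibniz e w" "leibniz e' w"
    using scale_double[of 1 "e \<bullet> w"] scale_double[of 1 "e' \<bullet> w"]
    by (auto intro!: leibniz_if_8
        simp: D_if_\<phi>_\<phi>_negated w \<phi>_mult \<phi>_line e_mult_\<phi>[OF w] D_line_8 bilinear)
qed

text \<open>The right side \<open>p\<close> of the rule, multiplied by \<open>8\<close>, is negated
  by \<phi> and so lies in the plane; its coefficients follow from \<open>e_mult_\<phi>\<close>.
  They match the rotation formula for \<open>D (w \<bullet> w')\<close>, as
  \<open>w \<bullet> w'\<close> is fixed by the square of \<phi>.\<close>

lemma leibniz_negated_negated:
  assumes w: "\<phi> (\<phi> w) = - w" and w': "\<phi> (\<phi> w') = - w'"
  shows "leibniz w w'"
proof (rule leibniz_if_8)
  define p where "p = \<phi> w \<bullet> w' + w \<bullet> \<phi> w'"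
  have "\<phi> p = - p" by (simp add: p_def \<phi>_simps \<phi>_mult w w' bilinear)
  then have p: "2 *s p = form e p *s e + form e' p *s e'" by (rule \<phi>_negated)
  have fix': "\<phi> (\<phi> (w \<bullet> w')) = w \<bullet> w'" by (simp add: \<phi>_mult w w' bilinear)
  have mult: "form x (y \<bullet> z) = form (x \<bullet> y) z" "form x (y \<bullet> z) = form (x \<bullet> z) y" for x y z
    by (metis form_assoc mult_commute)+
  have "form e p = form (e \<bullet> \<phi> w) w' + form (e \<bullet> \<phi> w') w"
    "form e' p = form (e' \<bullet> \<phi> w) w' + form (e' \<bullet> \<phi> w') w"
    unfolding p_def form_simps by (metis mult)+
  then have "form e p = 2 * form e' (w \<bullet> w')" "form e' p = - 2 * form e (w \<bullet> w')"
    unfolding e_mult_\<phi>[OF w] e_mult_\<phi>[OF w'] form_simps by (simp_all add: mult_commute[of w' w] flip: mult)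
  then have "2 *s p = 2 *s (8 *s D (w \<bullet> w'))"
    unfolding p D_if_\<phi>_\<phi>_fixed[OF fix'] by (simp add: scale_right_diff_distrib)
  then have "8 *s D (w \<bullet> w') = p" by (simp only: cancel_2)
  then show "8 *s D (w \<bullet> w') = w \<bullet> (8 *s D w') + (8 *s D w) \<bullet> w'"
    by (simp add: D_if_\<phi>_\<phi>_negated w w' p_def add.commute)
qed

text \<open>Decomposing the second argument settles first arguments from each piece; decomposing the
  first argument then gives the general case.\<close>

lemma comm_map_derivation: "D (x \<bullet> y) = x \<bullet> D y + D x \<bullet> y"
proof -
  have fixed: "leibniz v y" if v: "\<phi> v = v" for v y
    by (rule leibniz_commute, rule leibniz_decomposition)
      (auto intro: leibniz_fixed_fixed leibniz_line_fixed leibniz_commute leibniz_fixed_negated v)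
  have negated: "leibniz v y" if v: "\<phi> (\<phi> v) = - v" for v y
    by (rule leibniz_commute, rule leibniz_decomposition)
      (auto intro: leibniz_negated_negated leibniz_line_negated leibniz_fixed_negated v)
  have line: "leibniz e y" "leibniz e' y" for y
    by (rule leibniz_commute, rule leibniz_decomposition,
        auto intro: leibniz_line_line leibniz_commute fixed negated)+
  have "leibniz x y" by (rule leibniz_decomposition) (auto intro: fixed negated line)
  then show ?thesis by (simp only: leibniz_def)
qed

end

section \<open>The commutator as a derivation, and its component identities\<close>

context frobenius_algebra_odd
begin

lemma is_derivation_comm_map:
  assumes a: "axial a" and b: "axial b" and ab: "4 * form a b \<noteq> 1"
  shows "is_derivation scale mult (comm_map (mult a) (mult b))"
  unfolding is_derivation_def
proof (intro conjI allI)
  show "Vector_Spaces.linear scale scale (comm_map (mult a) (mult b))"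
    by unfold_locales (simp_all add: comm_map_def bilinear scale_right_diff_distrib)
  fix x y
  show "comm_map (mult a) (mult b) (x \<bullet> y) =
    x \<bullet> comm_map (mult a) (mult b) y + comm_map (mult a) (mult b) x \<bullet> y"
  proof (cases "2 * form a b = 1")
    case True
    then interpret right_angle scale mult form a b by unfold_locales (use a b in auto)
    show ?thesis using comm_map_derivation[of x y] by (simp only: D_def)
  next
    case False
    then show ?thesis
      unfolding comm_map_eq_half_part[OF a, of b]
      by (intro derivation_if_infinitesimal_axis[OF a axial_half_part[OF a]]
          axial_defect_half_part[OF a b ab])
  qed
qed

end

theorem theorem1p5:
  fixes scale :: "'f::field \<Rightarrow> 'a::ab_group_add \<Rightarrow> 'a"  (infixr \<open>*s\<close> 75)
    and mult :: "'a \<Rightarrow> 'a \<Rightarrow> 'a"  (infixl \<open>\<bullet>\<close> 76)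
    and form :: "'a \<Rightarrow> 'a \<Rightarrow> 'f"
    and a b :: 'a
  assumes char: "CHAR('f) \<noteq> 2"
    and alg: "frobenius_algebra scale mult form"
    and axis_a: "is_axis scale mult form a"
    and axis_b: "is_axis scale mult form b"
    and ab: "form a b \<notin> {1, 1/4}"
  shows "(let A0 = eigenspace scale mult 0 a; Ah = eigenspace scale mult (1/2) a;
              zero = comp_zero scale mult form a; bh = comp_half scale mult form a b
          in (\<forall>x\<in>Ah. \<forall>y\<in>Ah.
                bh \<bullet> (x \<bullet> y) + (bh \<bullet> x) \<bullet> y + (bh \<bullet> y) \<bullet> x
                  = (1/2 * form b y) *s x + (1/2 * form b x) *s y + form a (x \<bullet> y) *s bh) \<and>
             (\<forall>x\<in>Ah. \<forall>y\<in>A0.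
                zero (bh \<bullet> (x \<bullet> y)) = (bh \<bullet> x) \<bullet> y - zero ((bh \<bullet> y) \<bullet> x)))
         \<and> is_derivation scale mult (comm_map (mult a) (mult b))"
proof -
  interpret frobenius_algebra_odd scale mult form
    by (intro frobenius_algebra_odd.intro frobenius_algebra_odd_axioms.intro alg
        two_neq_0_if_CHAR_neq_2 char)
  have a: "axial a" and b: "axial b" using axis_a axis_b by (auto intro: is_axis_imp_axial)
  have "4 * form a b \<noteq> 1"
    using ab four_neq_0 by (auto simp: eq_divide_eq mult.commute)
  then have der: "is_derivation scale mult (comm_map (mult a) (mult b))"
    by (rule is_derivation_comm_map[OF a b])
  define h where "h = 2 *s (a \<bullet> b) - (2 * form a b) *s a"
  have h: "comp_half scale mult form a b = h" unfolding h_def by (rule comp_half_eq[OF a])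
  have half: "2 *s (a \<bullet> h) = h" unfolding h_def by (rule axial_half_part[OF a])
  have 1: "h \<bullet> (x \<bullet> y) + (h \<bullet> x) \<bullet> y + (h \<bullet> y) \<bullet> x
      = (1/2 * form b y) *s x + (1/2 * form b x) *s y + form a (x \<bullet> y) *s h"
    if "2 *s (a \<bullet> x) = x" "2 *s (a \<bullet> y) = y" for x y
  proof -
    have "2 *s (h \<bullet> (x \<bullet> y) + (h \<bullet> x) \<bullet> y + (h \<bullet> y) \<bullet> x)
      = 2 *s ((1/2 * form b y) *s x + (1/2 * form b x) *s y + form a (x \<bullet> y) *s h)"
      using derivation_half_half[OF a der that] two_neq_0
      by (simp add: h_def[symmetric] scale_right_distrib)
    then show ?thesis by (simp only: cancel_2)
  qed
  have 2: "comp_zero scale mult form a (h \<bullet> (x \<bullet> y)) =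
      (h \<bullet> x) \<bullet> y - comp_zero scale mult form a ((h \<bullet> y) \<bullet> x)"
    if x: "2 *s (a \<bullet> x) = x" and y: "a \<bullet> y = 0" for x y
  proof -
    have aa: "a \<bullet> a = a" "form a a = 1" by (rule axialD[OF a])+
    have "y \<bullet> a = 0" using y by (metis mult_commute)
    \<comment> \<open>Multiplications by \<open>a\<close> and \<open>y\<close> commute, and
      \<open>a \<bullet> (h \<bullet> x)\<close> is a multiple of \<open>a\<close>, which
      \<open>y\<close> kills. So \<open>(h \<bullet> x) \<bullet> y\<close> is its own zero
      component.\<close>
    then have "a \<bullet> (y \<bullet> (h \<bullet> x)) = 0"
      using axial_mult_commute[OF a y, of "h \<bullet> x"] axial_mult_half_half[OF a half x]
      by (simp add: bilinear)
    then have "a \<bullet> ((h \<bullet> x) \<bullet> y) = 0" by (simp only: mult_commute)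
    then have "comp_zero scale mult form a ((h \<bullet> x) \<bullet> y) = (h \<bullet> x) \<bullet> y" by (rule comp_zero_if[OF a])
    moreover have "h \<bullet> (x \<bullet> y) = (h \<bullet> x) \<bullet> y - (h \<bullet> y) \<bullet> x + form h (x \<bullet> y) *s a"
      unfolding h_def by (rule derivation_half_zero[OF a der x y])
    \<comment> \<open>Taking zero components is linear and removes the multiple of \<open>a\<close>
      left by \<open>derivation_half_zero\<close>.\<close>
    moreover have "comp_zero scale mult form a (v - w + k *s a) =
      comp_zero scale mult form a v - comp_zero scale mult form a w" for v w k
      using scale_double[of k a]
      by (simp add: comp_zero_eq[OF a] bilinear aa algebra_simps)
    ultimately show ?thesis by simp
  qed
  show ?thesis
    using 1 2 der by (simp add: Let_def h eigenspace_zero_iff eigenspace_half_iff)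
qed

end
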